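(* Let $0<p\leq q\leq\infty$. Then, for $n,k\in\mathbb{N}$, $$e_{k}\left(\mathrm{id}:\ell_{p}^{n}\rightarrow\ell_{q}^{n}\right)\sim\begin{cases} 1 & \text{if }1\leq k\leq\log_{2}(2n),\\ \left(k^{-1}\log_{2}\left(1+\frac{2n}{k}\right)\right)^{\frac{1}{p}-\frac{1}{q}} & \text{if }\log_{2}(2n)\leq k\leq2n,\\ 2^{-\frac{k}{2n}}\left(2n\right)^{\frac{1}{q}-\frac{1}{p}} & \text{if }k\geq2n. \end{cases}$$ Here $\sim$ means that there are constants $c,C>0$, independent of $n$ and $k$ (but possibly depending on $p$ and $q$), such that the left-hand side is at least $c$ times and at most $C$ times the right-hand side.
   Context: $\ell_p^n$ is $\mathbb{C}^n$ with the (quasi-)norm $\Vert a\Vert_p=\big(\sum_{j=1}^n|a_j|^p\big)^{1/p}$ for $0<p<\infty$, and $\Vert a\Vert_\infty=\max_{1\leq j\leq n}|a_j|$; the scalars are complex. The convention $1/\infty=0$ is used. For quasi-normed spaces $\mathbb{X},\mathbb{Y}$ with closed unit balls $\overline{B}_{\mathbb{X}},\overline{B}_{\mathbb{Y}}$, a bounded linear $T:\mathbb{X}\to\mathbb{Y}$ and $k\in\mathbb{N}=\{1,2,\ldots\}$, the $k$-th (dyadic) entropy number is $$e_{k}(T):=\inf\Big\{\varepsilon>0:\ \exists\,y_{1},\ldots,y_{2^{k-1}}\in\mathbb{Y}:\ T(\overline{B}_{\mathbb{X}})\subseteq\bigcup_{i=1}^{2^{k-1}}\{y_{i}+\varepsilon\overline{B}_{\mathbb{Y}}\}\Big\}.$$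 $\mathrm{id}:\ell_p^n\to\ell_q^n$ is the identity map. *)

theory Defs
  imports Complex_Main "HOL-Library.Extended_Real" "Jordan_Normal_Form.Matrix"
begin

text \<open>
  Exponents range over the type of extended reals, so that \<^term>\<open>\<infinity>\<close> is available.
  The maximum below is unspecified for vectors of dimension \<open>0\<close>.
\<close>

definition lp_norm :: "ereal \<Rightarrow> complex vec \<Rightarrow> real" where
  "lp_norm p x =
    (if p = \<infinity> then Max ((\<lambda>j. cmod (x $ j)) ` {..<dim_vec x})
     else (\<Sum>j<dim_vec x. cmod (x $ j) powr real_of_ereal p) powr (1 / real_of_ereal p))"

text \<open>
  A (quasi-)normed space is given by its set of points and its (quasi-)norm. The dimension
  of \<open>\<complex>\<^sup>n\<close> is a term, since it has to be quantified after the constants of an estimate.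
\<close>

type_synonym 'a qspace = "'a set \<times> ('a \<Rightarrow> real)"

definition lp_space :: "ereal \<Rightarrow> nat \<Rightarrow> complex vec qspace" where
  "lp_space p n = (carrier_vec n, lp_norm p)"

definition unit_cball :: "'a qspace \<Rightarrow> 'a set" where
  "unit_cball X = {x \<in> fst X. snd X x \<le> 1}"

text \<open>
  Dyadic entropy numbers, for \<open>k \<ge> 1\<close>. For a bounded map \<open>T\<close> the set of admissible radii is
  nonempty, so the infimum is the genuine one.
\<close>

definition entropy_number ::
  "nat \<Rightarrow> 'a qspace \<Rightarrow> complex vec qspace \<Rightarrow> ('a \<Rightarrow> complex vec) \<Rightarrow> real" where
  "entropy_number k X Y T =
    Inf {\<epsilon>. \<epsilon> > 0 \<and>
      (\<exists>y :: nat \<Rightarrow> complex vec. (\<forall>i \<in> {1..2 ^ (k - 1)}. y i \<in> fst Y) \<and>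
        T ` unit_cball X \<subseteq>
          (\<Union>i \<in> {1..2 ^ (k - 1)}. (\<lambda>z. y i + complex_of_real \<epsilon> \<cdot>\<^sub>v z) ` unit_cball Y))}"

end

theory Submission
  imports Defs
begin

text \<open>
  Put \<open>s = 1/p - 1/q\<close>. All estimates come from counting points of the Gaussian integer lattice
  or words of a code; no volumes are used.

  Upper bounds. Every \<open>x\<close> in the unit ball of \<open>\<ell>\<^sub>p\<^sup>n\<close> is rounded coordinatewise towards zero to
  the lattice \<open>h\<int>[i]\<^sup>n\<close>. Rounding towards zero does not increase moduli, so the rounded vector is
  \<open>h z\<close> with \<open>z\<close> a Gaussian integer vector and \<open>\<parallel>z\<parallel>\<^sub>p \<le> 1/h\<close>, and the number of such \<open>z\<close> is the size
  of a covering (\<open>admissible_by_rounding\<close>). The error \<open>d\<close> satisfies \<open>\<bar>d\<^sub>j\<bar> \<le> 2h\<close> and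
  \<open>\<bar>d\<^sub>j\<bar> \<le> \<bar>x\<^sub>j\<bar>\<close>, whence \<open>\<parallel>d\<parallel>\<^sub>q \<le> 2h n\<^bsup>1/q\<^esup>\<close> and, interpolating between \<open>\<ell>\<^sub>p\<close> and \<open>\<ell>\<^sub>\<infinity>\<close>,
  \<open>\<parallel>d\<parallel>\<^sub>q \<le> (2h)\<^bsup>ps\<^esup>\<close>. If \<open>h\<close> is of order \<open>2\<^bsup>-k/2n\<^esup> n\<^bsup>-1/p\<^esup>\<close>, the lattice count is
  \<open>(C / (h n\<^bsup>1/p\<^esup>))\<^bsup>2n\<^esup>\<close> (\<open>card_gaussian_vecs_dense\<close>), and the first error estimate gives the bound
  for large \<open>k\<close>. If \<open>h = m\<^bsup>-1/p\<^esup>\<close> with \<open>m \<le> n\<close>, then \<open>\<Sum>\<bar>z\<^sub>j\<bar>\<^sup>p \<le> m\<close> forces \<open>z\<close> to be sparse, the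
  count is only \<open>(C n / m)\<^sup>m\<close> (\<open>card_gaussian_vecs_sparse\<close>), and with \<open>m\<close> of order
  \<open>k / log\<^sub>2 (1 + 2n/k)\<close> the second error estimate gives the middle bound.

  Lower bounds. By pigeonhole some ball of any covering contains many points of a given finite
  set, and two points of a ball of radius \<open>\<epsilon>\<close> have distance at most \<open>2\<^bsup>1+1/q\<^esup> \<epsilon>\<close>
  (\<open>entropy_number_ge_of_packing\<close>). For small \<open>k\<close> the points are the unit vectors and \<open>0\<close>. For large
  \<open>k\<close> they are a full grid in the cube of side length comparable with \<open>n\<^bsup>-1/p\<^esup>\<close>, and the lattice
  count above bounds the points that a ball can contain. For middle \<open>k\<close> the coordinates are divided
  into \<open>m\<close> blocks of size \<open>B\<close>, and each point has one nonzero entry \<open>m\<^bsup>-1/p\<^esup>\<close> per block; two such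
  points are far apart unless they agree on half of the blocks, and a Hamming ball of radius \<open>m/2\<close>
  contains at most \<open>2\<^sup>m B\<^bsup>m/2\<^esup>\<close> of the \<open>B\<^sup>m\<close> words.

  All the counting is done by one weighting argument, \<open>card_le_of_product_weights\<close>.
\<close>

section \<open>The quasi-norms of \<open>\<ell>\<^sub>p\<^sup>n\<close>\<close>

abbreviation recip :: "ereal \<Rightarrow> real" where
  "recip p \<equiv> real_of_ereal (1 / p)"

lemma pos_ereal_cases:
  assumes "0 < (p::ereal)"
  obtains (infinite) "p = \<infinity>" | (finite) r where "p = ereal r" "0 < r" "recip p = 1 / r"
  using assms by (cases p) (auto simp: one_ereal_def)

lemma recip_nonneg: "0 < p \<Longrightarrow> 0 \<le> recip p"
  by (erule pos_ereal_cases) auto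

lemma recip_antimono:
  assumes "0 < p" "p \<le> q"
  shows "recip q \<le> recip p"
proof -
  from assms have "0 < q" by simp
  with assms show ?thesis
    by (auto elim!: pos_ereal_cases intro!: divide_left_mono)
qed

lemma lp_norm_infinity_le_iff:
  assumes "0 < dim_vec x"
  shows "lp_norm \<infinity> x \<le> a \<longleftrightarrow> (\<forall>j<dim_vec x. cmod (x $ j) \<le> a)"
proof -
  have "(\<lambda>j. cmod (x $ j)) ` {..<dim_vec x} \<noteq> {}"
    using assms by auto
  then show ?thesis by (auto simp: lp_norm_def)
qed

lemma lp_norm_nonneg:
  assumes "0 < dim_vec x"
  shows "0 \<le> lp_norm p x"
proof (cases "p = \<infinity>")
  case True
  have "cmod (x $ 0) \<le> lp_norm \<infinity> x"
    using assms lp_norm_infinity_le_iff[of x "lp_norm \<infinity> x"] by auto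
  then show ?thesis unfolding True using norm_ge_zero[of "x $ 0"] by linarith
qed (simp add: lp_norm_def)

lemma lp_norm_finite_le_iff:
  assumes "0 < r" "0 \<le> a"
  shows "lp_norm (ereal r) x \<le> a \<longleftrightarrow> (\<Sum>j<dim_vec x. cmod (x $ j) powr r) \<le> a powr r"
proof -
  let ?S = "\<Sum>j<dim_vec x. cmod (x $ j) powr r"
  have S: "0 \<le> ?S" by (simp add: sum_nonneg)
  have "lp_norm (ereal r) x \<le> a \<longleftrightarrow> ?S powr (1 / r) \<le> a"
    by (simp add: lp_norm_def)
  also have "\<dots> \<longleftrightarrow> (?S powr (1 / r)) powr r \<le> a powr r"
    using assms by (metis powr_ge_zero powr_less_mono2 powr_mono2 less_imp_le not_le)
  also have "(?S powr (1 / r)) powr r = ?S"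
    using assms S by (simp add: powr_powr)
  finally show ?thesis .
qed

lemma cmod_le_lp_norm:
  assumes "0 < p" "j < dim_vec x"
  shows "cmod (x $ j) \<le> lp_norm p x"
  using assms(1)
proof (cases rule: pos_ereal_cases)
  case infinite
  then show ?thesis using assms lp_norm_infinity_le_iff[of x "lp_norm p x"] by auto
next
  case (finite r)
  have "cmod (x $ j) powr r \<le> (\<Sum>j<dim_vec x. cmod (x $ j) powr r)"
    using assms by (intro member_le_sum) auto
  also have "\<dots> \<le> lp_norm p x powr r"
    using lp_norm_finite_le_iff[of r "lp_norm p x" x] finite assms
    by (auto simp: lp_norm_nonneg)
  finally show ?thesis
    using finite assms lp_norm_nonneg[of x p]
    by (metis dual_order.strict_trans1 linorder_not_le powr_less_mono2 zero_le)
qed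

text \<open>
  The support may be smaller than the dimension; this is what makes normalised sparse vectors lie
  in the unit ball.
\<close>

lemma lp_norm_le_of_support:
  assumes "0 < p" "0 < dim_vec x" "0 \<le> a"
    and "\<And>j. j < dim_vec x \<Longrightarrow> cmod (x $ j) \<le> a"
    and "real (card {j. j < dim_vec x \<and> x $ j \<noteq> 0}) \<le> m" "0 < m"
  shows "lp_norm p x \<le> a * m powr recip p"
  using assms(1)
proof (cases rule: pos_ereal_cases)
  case infinite
  then show ?thesis using assms lp_norm_infinity_le_iff[of x a] by auto
next
  case (finite r)
  let ?J = "{j. j < dim_vec x \<and> x $ j \<noteq> 0}"
  have "(\<Sum>j<dim_vec x. cmod (x $ j) powr r) = (\<Sum>j\<in>?J. cmod (x $ j) powr r)"
    by (intro sum.mono_neutral_right) auto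
  also have "\<dots> \<le> (\<Sum>j\<in>?J. a powr r)"
    using assms finite by (intro sum_mono powr_mono2) auto
  also have "\<dots> \<le> m * a powr r"
    using assms by (simp add: mult_right_mono)
  also have "\<dots> = (a * m powr recip p) powr r"
    using finite assms by (simp add: powr_mult powr_powr)
  finally show ?thesis
    using finite assms by (simp add: lp_norm_finite_le_iff)
qed

lemma lp_norm_le_of_bound:
  assumes "0 < p" "0 < dim_vec x" "0 \<le> a"
    and "\<And>j. j < dim_vec x \<Longrightarrow> cmod (x $ j) \<le> a"
  shows "lp_norm p x \<le> a * real (dim_vec x) powr recip p"
proof (rule lp_norm_le_of_support[OF assms])
  have "card {j. j < dim_vec x \<and> x $ j \<noteq> 0} \<le> card {..<dim_vec x}"
    by (intro card_mono) auto
  then show "real (card {j. j < dim_vec x \<and> x $ j \<noteq> 0}) \<le> real (dim_vec x)" by simp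
qed (use assms in auto)

lemma lp_norm_ge_of_large_entries:
  assumes "0 < q" "0 < a" "J \<subseteq> {..<dim_vec x}" "J \<noteq> {}"
    and "\<And>j. j \<in> J \<Longrightarrow> a \<le> cmod (x $ j)"
  shows "a * real (card J) powr recip q \<le> lp_norm q x"
proof -
  from assms obtain j where j: "j \<in> J" by blast
  then have n: "0 < dim_vec x" using assms by auto
  have J: "finite J" using assms finite_subset by auto
  from J assms(4) have cJ: "0 < card J" by auto
  show ?thesis using assms(1)
  proof (cases rule: pos_ereal_cases)
    case infinite
    have "a \<le> cmod (x $ j)" using assms j by auto
    also have "\<dots> \<le> lp_norm q x" using assms j by (intro cmod_le_lp_norm) auto
    finally show ?thesis using infinite cJ by simp
  next
    case (finite r)
    have "(a * real (card J) powr recip q) powr r = (\<Sum>j\<in>J. a powr r)"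
      using finite assms cJ by (simp add: powr_mult powr_powr)
    also have "\<dots> \<le> (\<Sum>j\<in>J. cmod (x $ j) powr r)"
      using assms finite by (intro sum_mono powr_mono2) auto
    also have "\<dots> \<le> (\<Sum>j<dim_vec x. cmod (x $ j) powr r)"
      using assms by (intro sum_mono2) auto
    also have "\<dots> \<le> lp_norm q x powr r"
      using lp_norm_finite_le_iff[of r "lp_norm q x" x] finite assms n
      by (auto simp: lp_norm_nonneg)
    finally show ?thesis
      using finite assms n by (metis linorder_not_le lp_norm_nonneg powr_less_mono2)
  qed
qed

text \<open>
  The substitute for the triangle inequality. The constant need not be sharp, and
  \<open>\<bar>a + b\<bar>\<^sup>q \<le> 2\<^sup>q (\<bar>a\<bar>\<^sup>q + \<bar>b\<bar>\<^sup>q)\<close> holds for all finite exponents.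
\<close>

lemma lp_norm_diff_le:
  assumes q: "0 < q" and n: "dim_vec x = n" "dim_vec y = n" "0 < n"
    and x: "lp_norm q x \<le> a" and y: "lp_norm q y \<le> a"
  shows "lp_norm q (x - y) \<le> 2 powr (1 + recip q) * a"
proof -
  have a: "0 \<le> a" using lp_norm_nonneg[of x q] assms by auto
  show ?thesis using q
  proof (cases rule: pos_ereal_cases)
    case infinite
    have "cmod (x $ j - y $ j) \<le> 2 * a" if "j < n" for j
      using x y infinite that n lp_norm_infinity_le_iff[of x a] lp_norm_infinity_le_iff[of y a]
      by (smt (verit, best) norm_triangle_ineq4)
    then show ?thesis
      using infinite n lp_norm_infinity_le_iff[of "x - y" "2 * a"] by simp
  next
    case (finite r)
    let ?f = "\<lambda>z. \<Sum>j<n. cmod (z $ j) powr r"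
    have *: "(s + t) powr r \<le> 2 powr r * (s powr r + t powr r)" if "0 \<le> s" "0 \<le> t" for s t :: real
    proof -
      have "(s + t) powr r \<le> (2 * max s t) powr r"
        using that finite by (intro powr_mono2) auto
      also have "\<dots> = 2 powr r * max s t powr r"
        using that by (simp add: powr_mult)
      also have "max s t powr r \<le> s powr r + t powr r"
        by (simp add: max_def)
      finally show ?thesis by simp
    qed
    have "(\<Sum>j<n. cmod ((x - y) $ j) powr r)
        \<le> (\<Sum>j<n. 2 powr r * (cmod (x $ j) powr r + cmod (y $ j) powr r))"
    proof (intro sum_mono)
      fix j assume "j \<in> {..<n}"
      then have "cmod ((x - y) $ j) powr r \<le> (cmod (x $ j) + cmod (y $ j)) powr r"
        using n finite by (intro powr_mono2) (auto intro: norm_triangle_ineq4)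
      also have "\<dots> \<le> 2 powr r * (cmod (x $ j) powr r + cmod (y $ j) powr r)"
        by (rule *) auto
      finally show "cmod ((x - y) $ j) powr r
          \<le> 2 powr r * (cmod (x $ j) powr r + cmod (y $ j) powr r)" .
    qed
    also have "\<dots> = 2 powr r * (?f x + ?f y)"
      by (simp add: sum.distrib sum_distrib_left[symmetric])
    also have "\<dots> \<le> 2 powr r * (a powr r + a powr r)"
      using x y n finite a by (intro mult_left_mono add_mono) (auto simp: lp_norm_finite_le_iff)
    also have "\<dots> = (2 powr (1 + recip q) * a) powr r"
      using finite a by (simp add: powr_mult powr_powr powr_add field_simps)
    finally show ?thesis
      using finite a n by (simp add: lp_norm_finite_le_iff)
  qed
qed

lemma lp_norm_smult:
  assumes "0 < q" "0 < dim_vec x"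
  shows "lp_norm q (c \<cdot>\<^sub>v x) = cmod c * lp_norm q x"
  using assms(1)
proof (cases rule: pos_ereal_cases)
  case infinite
  have "Max ((\<lambda>j. cmod (c * x $ j)) ` {..<dim_vec x})
      = Max ((\<lambda>t. cmod c * t) ` (\<lambda>j. cmod (x $ j)) ` {..<dim_vec x})"
    by (simp add: image_image norm_mult)
  also have "\<dots> = cmod c * Max ((\<lambda>j. cmod (x $ j)) ` {..<dim_vec x})"
    using assms
    by (intro mono_Max_commute[symmetric]) (auto simp: mono_def mult_left_mono)
  finally show ?thesis using infinite by (simp add: lp_norm_def)
next
  case (finite r)
  then show ?thesis
    by (simp add: lp_norm_def norm_mult powr_mult sum_distrib_left[symmetric] powr_powr)
qed

text \<open>
  Interpolation between \<open>\<ell>\<^sub>p\<close> and \<open>\<ell>\<^sub>\<infinity>\<close>: for finite \<open>q\<close> it is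
  \<open>\<Sum>\<bar>x\<^sub>j\<bar>\<^sup>q \<le> a\<^bsup>q-p\<^esup> \<Sum>\<bar>x\<^sub>j\<bar>\<^sup>p\<close>.
\<close>

lemma lp_norm_interpolate:
  assumes p: "0 < p" "p = ereal r" "p \<le> q" and a: "0 < a" and n: "0 < dim_vec x"
    and x: "lp_norm p x \<le> 1" "\<And>j. j < dim_vec x \<Longrightarrow> cmod (x $ j) \<le> a"
  shows "lp_norm q x \<le> a powr (r * (recip p - recip q))"
proof -
  have r: "0 < r" "recip p = 1 / r" using p by (auto simp: one_ereal_def)
  have "0 < q" using p less_le_trans by blast
  then show ?thesis
  proof (cases rule: pos_ereal_cases)
    case infinite
    then show ?thesis using n a r x lp_norm_infinity_le_iff[of x a] by simp
  next
    case (finite s)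
    have rs: "r \<le> s" using p finite by auto
    have "(\<Sum>j<dim_vec x. cmod (x $ j) powr s)
        \<le> (\<Sum>j<dim_vec x. cmod (x $ j) powr r * a powr (s - r))"
    proof (intro sum_mono)
      fix j assume "j \<in> {..<dim_vec x}"
      then have "cmod (x $ j) powr (s - r) \<le> a powr (s - r)"
        using x rs by (intro powr_mono2) auto
      then have "cmod (x $ j) powr r * cmod (x $ j) powr (s - r) \<le> cmod (x $ j) powr r * a powr (s - r)"
        by (intro mult_left_mono) auto
      then show "cmod (x $ j) powr s \<le> cmod (x $ j) powr r * a powr (s - r)"
        by (simp add: powr_add[symmetric])
    qed
    also have "\<dots> = (\<Sum>j<dim_vec x. cmod (x $ j) powr r) * a powr (s - r)"
      by (simp add: sum_distrib_right)
    also have "\<dots> \<le> 1 * a powr (s - r)"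
      using x p r by (intro mult_right_mono) (auto simp: lp_norm_finite_le_iff)
    also have "\<dots> = (a powr (r * (recip p - recip q))) powr s"
      using finite r by (simp add: powr_powr field_simps)
    finally show ?thesis
      using finite by (simp add: lp_norm_finite_le_iff)
  qed
qed

lemma lp_norm_le_one_mono:
  assumes p: "0 < p" "p \<le> q" and n: "0 < dim_vec x" and x: "lp_norm p x \<le> 1"
  shows "lp_norm q x \<le> 1"
  using p(1)
proof (cases rule: pos_ereal_cases)
  case infinite
  then show ?thesis using p x by simp
next
  case (finite r)
  have "cmod (x $ j) \<le> 1" if "j < dim_vec x" for j
    using cmod_le_lp_norm[OF p(1) that] x by linarith
  then show ?thesis
    using lp_norm_interpolate[of p r q 1 x] p finite n x by auto
qed

text \<open>
  For every exponent \<open>r\<close>, however small, polynomial weights in \<open>u\<close> are controlled by the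
  exponential of \<open>u\<^sup>r\<close>.
\<close>

lemma one_plus_le_exp_powr:
  fixes u r :: real
  assumes "0 \<le> u" "0 < r"
  shows "1 + u \<le> exp (1 + u powr r / r)"
proof -
  let ?v = "u powr r"
  have v: "0 \<le> ?v" by simp
  have "u = ?v powr (1 / r)" using assms by (simp add: powr_powr)
  also have "\<dots> \<le> (1 + ?v) powr (1 / r)"
    using assms by (intro powr_mono2) auto
  finally have "u \<le> (1 + ?v) powr (1 / r)" .
  moreover have "1 \<le> (1 + ?v) powr (1 / r)"
    using assms v by (intro ge_one_powr_ge_zero) auto
  ultimately have "1 + u \<le> 2 * (1 + ?v) powr (1 / r)" by simp
  also have "\<dots> \<le> exp 1 * exp ?v powr (1 / r)"
    using assms v exp_ge_add_one_self[of 1]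
    by (intro mult_mono powr_mono2 exp_ge_add_one_self) auto
  also have "\<dots> = exp (1 + ?v / r)"
    by (simp add: exp_powr_real exp_add)
  finally show ?thesis .
qed

text \<open>
  A bound on the norm, normalised by the dimension, bounds the geometric mean of the numbers
  \<open>1 + \<bar>x\<^sub>j\<bar>/T\<close> by a constant depending only on \<open>p\<close>. This single form serves all exponents,
  \<open>\<infinity>\<close> included, and the product is what the weighting argument below needs.
\<close>

lemma prod_one_plus_le_of_lp_norm:
  assumes p: "0 < p" and n: "dim_vec x = n" "0 < n" and T: "0 < T"
    and x: "lp_norm p x \<le> T * real n powr recip p"
  shows "(\<Prod>j<n. 1 + cmod (x $ j) / T) \<le> exp (1 + recip p) ^ n"
  using p
proof (cases rule: pos_ereal_cases)
  case infinite
  have "(\<Prod>j<n. 1 + cmod (x $ j) / T) \<le> (\<Prod>j<n. exp 1)"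
  proof (intro prod_mono conjI)
    fix j assume "j \<in> {..<n}"
    then have "cmod (x $ j) \<le> T"
      using infinite x n lp_norm_infinity_le_iff[of x T] by simp
    then have "cmod (x $ j) / T \<le> 1" using T by simp
    then show "1 + cmod (x $ j) / T \<le> exp 1"
      using exp_ge_add_one_self[of "1::real"] by linarith
    show "0 \<le> 1 + cmod (x $ j) / T" using T by simp
  qed
  then show ?thesis using infinite by simp
next
  case (finite r)
  let ?u = "\<lambda>j. cmod (x $ j) / T"
  have "(\<Prod>j<n. 1 + ?u j) \<le> (\<Prod>j<n. exp (1 + ?u j powr r / r))"
    using T finite by (intro prod_mono conjI one_plus_le_exp_powr) auto
  also have "\<dots> = exp (\<Sum>j<n. 1 + ?u j powr r / r)"
    by (simp add: exp_sum)
  also have "(\<Sum>j<n. 1 + ?u j powr r / r)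
      = real n + (\<Sum>j<n. cmod (x $ j) powr r) / (r * T powr r)"
    using T by (simp add: sum.distrib powr_divide sum_divide_distrib mult.commute)
  also have "(\<Sum>j<n. cmod (x $ j) powr r) \<le> (T * real n powr recip p) powr r"
    using x n finite T by (subst (asm) finite(1)) (simp add: lp_norm_finite_le_iff)
  also have "(T * real n powr recip p) powr r = T powr r * real n"
    using T n finite by (simp add: powr_mult powr_powr)
  also have "exp (real n + T powr r * real n / (r * T powr r)) = exp (1 + recip p) ^ n"
    using T n finite by (simp add: exp_of_nat_mult[symmetric] field_simps)
  finally show ?thesis
    using finite T by (simp add: divide_right_mono)
qed

section \<open>Counting Gaussian integer vectors in balls\<close>

text \<open>
  Counting with weights: the total weight of all words factorises over the coordinates, and
  each element of \<open>S\<close> contributes at least \<open>\<theta>\<close> to it.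
\<close>

lemma card_le_of_product_weights:
  fixes w :: "'i \<Rightarrow> 'd \<Rightarrow> real"
  assumes J: "finite J" and D: "finite D" and S: "S \<subseteq> Pi\<^sub>E J (\<lambda>_. D)"
    and w: "\<And>j d. j \<in> J \<Longrightarrow> d \<in> D \<Longrightarrow> 0 \<le> w j d"
    and A: "\<And>j. j \<in> J \<Longrightarrow> (\<Sum>d\<in>D. w j d) \<le> A"
    and \<theta>: "\<And>z. z \<in> S \<Longrightarrow> \<theta> \<le> (\<Prod>j\<in>J. w j (z j))"
  shows "\<theta> * real (card S) \<le> A ^ card J"
proof -
  have "\<theta> * real (card S) = (\<Sum>z\<in>S. \<theta>)" by simp
  also have "\<dots> \<le> (\<Sum>z\<in>S. \<Prod>j\<in>J. w j (z j))"
    by (intro sum_mono \<theta>)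
  also have "\<dots> \<le> (\<Sum>z\<in>Pi\<^sub>E J (\<lambda>_. D). \<Prod>j\<in>J. w j (z j))"
    using J D S w by (intro sum_mono2 finite_PiE prod_nonneg) (auto simp: PiE_iff)
  also have "\<dots> = (\<Prod>j\<in>J. \<Sum>d\<in>D. w j d)"
    using J D by (simp add: prod_sum_PiE)
  also have "\<dots> \<le> (\<Prod>j\<in>J. A)"
    using w A by (intro prod_mono conjI sum_nonneg) auto
  finally show ?thesis by simp
qed

text \<open>
  The summands are dominated by differences of \<open>T / (1 + i/T)\<close>, so the sum telescopes. The
  linear dependence on \<open>T\<close> is what makes the dense count below sharp up to \<open>C\<^bsup>2n\<^esup>\<close>.
\<close>

lemma sum_inverse_squares_le:
  fixes T :: real
  assumes "1 \<le> T"
  shows "(\<Sum>i\<in>{-int M..int M}. 1 / (1 + \<bar>real_of_int i\<bar> / T)\<^sup>2) \<le> 3 * T"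
proof -
  let ?f = "\<lambda>i::int. 1 / (1 + \<bar>real_of_int i\<bar> / T)\<^sup>2"
  \<comment> \<open>The terms from \<open>i = 1\<close> to \<open>M\<close> sum to at most \<open>T - g M\<close>, and those with negative \<open>i\<close> likewise.\<close>
  define g where "g M = T / (1 + real M / T)" for M
  have "(\<Sum>i\<in>{-int M..int M}. ?f i) \<le> 1 + 2 * (T - g M)"
  proof (induction M)
    case 0
    then show ?case by (simp add: g_def)
  next
    case (Suc M)
    have "{-int (Suc M)..int (Suc M)} = insert (int (Suc M)) (insert (- int (Suc M)) {-int M..int M})"
      by auto
    then have "(\<Sum>i\<in>{-int (Suc M)..int (Suc M)}. ?f i)
        = 2 * (1 / (1 + real (Suc M) / T)\<^sup>2) + (\<Sum>i\<in>{-int M..int M}. ?f i)"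
      by (simp add: add.commute)
    moreover have "1 / (1 + real (Suc M) / T)\<^sup>2 \<le> g M - g (Suc M)"
    proof -
      let ?a = "1 + real M / T" and ?b = "1 + real (Suc M) / T"
      have ab: "0 < ?a" "0 < ?b" "?a \<le> ?b" "T * (?b - ?a) = 1"
        using assms by (auto simp: field_simps add_pos_nonneg)
      have "T / ?a - T / ?b = T * (?b - ?a) / (?a * ?b)"
        using ab(1,2) by (simp only: diff_frac_eq less_imp_neq[symmetric] not_False_eq_True) (simp only: right_diff_distrib)
      also have "\<dots> = 1 / (?a * ?b)" using ab by simp
      also have "\<dots> \<ge> 1 / ?b\<^sup>2"
        unfolding power2_eq_square
        by (intro divide_left_mono mult_right_mono mult_pos_pos) (use ab in linarith)+
      finally show ?thesis by (simp add: g_def)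
    qed
    moreover have "a \<le> 1 + 2 * (T - e)"
      if "a = 2 * b + c" "b \<le> d - e" "c \<le> 1 + 2 * (T - d)" for a b c d e
      using that by argo
    ultimately show ?case using Suc by blast
  qed
  also have "\<dots> \<le> 3 * T"
  proof -
    have "0 \<le> g M" using assms by (simp add: g_def)
    then show ?thesis using assms by argo
  qed
  finally show ?thesis .
qed

definition gaussian_vec :: "nat \<Rightarrow> (nat \<Rightarrow> int \<times> int) \<Rightarrow> complex vec" where
  "gaussian_vec n z = vec n (\<lambda>j. Complex (of_int (fst (z j))) (of_int (snd (z j))))"

definition gaussian_box :: "nat \<Rightarrow> nat \<Rightarrow> (nat \<Rightarrow> int \<times> int) set" where
  "gaussian_box n M = Pi\<^sub>E {..<n} (\<lambda>_. {-int M..int M} \<times> {-int M..int M})"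

lemma dim_gaussian_vec [simp]: "dim_vec (gaussian_vec n z) = n"
  by (simp add: gaussian_vec_def)

lemma gaussian_vec_carrier [simp]: "gaussian_vec n z \<in> carrier_vec n"
  by (simp add: gaussian_vec_def)

lemma finite_gaussian_box [simp]: "finite (gaussian_box n M)"
  unfolding gaussian_box_def by (intro finite_PiE) auto

definition gaussian_weight :: "real \<Rightarrow> int \<times> int \<Rightarrow> real" where
  "gaussian_weight T d =
     1 / (1 + \<bar>real_of_int (fst d)\<bar> / T)\<^sup>2 * (1 / (1 + \<bar>real_of_int (snd d)\<bar> / T)\<^sup>2)"

lemma sum_gaussian_weight_le:
  assumes "1 \<le> T"
  shows "(\<Sum>d\<in>{-int M..int M} \<times> {-int M..int M}. gaussian_weight T d) \<le> (3 * T)\<^sup>2"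
proof -
  let ?g = "\<lambda>i::int. 1 / (1 + \<bar>real_of_int i\<bar> / T)\<^sup>2"
  have "(\<Sum>d\<in>{-int M..int M} \<times> {-int M..int M}. gaussian_weight T d)
      = (\<Sum>i\<in>{-int M..int M}. ?g i) * (\<Sum>i\<in>{-int M..int M}. ?g i)"
    by (simp only: gaussian_weight_def sum_product sum.cartesian_product case_prod_unfold)
  also have "\<dots> \<le> (3 * T) * (3 * T)"
    using assms by (intro mult_mono sum_inverse_squares_le sum_nonneg) auto
  finally show ?thesis by (simp add: power2_eq_square)
qed

lemma gaussian_weight_ge:
  assumes "0 < T" "j < n"
  shows "1 / (1 + cmod (gaussian_vec n z $ j) / T) ^ 4 \<le> gaussian_weight T (z j)"
proof -
  let ?c = "cmod (gaussian_vec n z $ j)"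
  let ?a = "1 + \<bar>real_of_int (fst (z j))\<bar> / T" and ?b = "1 + \<bar>real_of_int (snd (z j))\<bar> / T"
  let ?s = "1 + ?c / T"
  have "\<bar>real_of_int (fst (z j))\<bar> \<le> ?c" "\<bar>real_of_int (snd (z j))\<bar> \<le> ?c"
    using assms abs_Re_le_cmod[of "gaussian_vec n z $ j"] abs_Im_le_cmod[of "gaussian_vec n z $ j"]
    by (auto simp: gaussian_vec_def)
  then have le: "?a \<le> ?s" "?b \<le> ?s"
    using assms by (auto intro: divide_right_mono)
  have pos: "0 < ?a" "0 < ?b" using assms by (auto intro: add_pos_nonneg)
  have "gaussian_weight T (z j) = 1 / (?a\<^sup>2 * ?b\<^sup>2)"
    by (simp add: gaussian_weight_def)
  also have "\<dots> \<ge> 1 / (?s\<^sup>2 * ?s\<^sup>2)"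
    using le pos by (intro divide_left_mono mult_mono power_mono mult_pos_pos zero_less_power) auto
  also have "?s\<^sup>2 * ?s\<^sup>2 = ?s ^ 4" by (simp add: power_add[symmetric])
  finally show ?thesis .
qed

text \<open>
  The ball has radius \<open>T n\<^bsup>1/p\<^esup>\<close>, so that an average coordinate has size \<open>T\<close>; the weights have
  the scale \<open>T\<close> as well. The weight of a vector in the ball is then at least \<open>C\<^bsup>-n\<^esup>\<close>, whereas the
  total weight is at most \<open>(3T)\<^bsup>2n\<^esup>\<close>.
\<close>

lemma card_gaussian_vecs_dense:
  assumes p: "0 < p" and n: "0 < n" and T: "1 \<le> T"
  shows "real (card {z \<in> gaussian_box n M. lp_norm p (gaussian_vec n z) \<le> T * real n powr recip p})
    \<le> (3 * exp (2 * (1 + recip p)) * T) ^ (2 * n)"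
proof -
  let ?S = "{z \<in> gaussian_box n M. lp_norm p (gaussian_vec n z) \<le> T * real n powr recip p}"
  define K where "K = exp (1 + recip p)"
  have K: "0 < K" by (simp add: K_def)
  have "1 / (K ^ n) ^ 4 * real (card ?S) \<le> ((3 * T)\<^sup>2) ^ card {..<n}"
  proof (rule card_le_of_product_weights[where D = "{-int M..int M} \<times> {-int M..int M}"
        and w = "\<lambda>_. gaussian_weight T"])
    show "?S \<subseteq> {..<n} \<rightarrow>\<^sub>E {-int M..int M} \<times> {-int M..int M}"
      by (auto simp: gaussian_box_def)
    show "(\<Sum>d\<in>{-int M..int M} \<times> {-int M..int M}. gaussian_weight T d) \<le> (3 * T)\<^sup>2" for j :: nat
      by (rule sum_gaussian_weight_le[OF T])
    fix z assume z: "z \<in> ?S"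
    let ?P = "\<Prod>j<n. 1 + cmod (gaussian_vec n z $ j) / T"
    have P: "?P \<le> K ^ n"
      unfolding K_def using z p n T by (intro prod_one_plus_le_of_lp_norm) auto
    have P0: "0 < ?P" using T by (intro prod_pos) (auto intro: add_pos_nonneg)
    have "1 / (K ^ n) ^ 4 \<le> 1 / ?P ^ 4"
      using P P0 K by (intro divide_left_mono power_mono mult_pos_pos zero_less_power) auto
    also have "\<dots> = (\<Prod>j<n. 1 / (1 + cmod (gaussian_vec n z $ j) / T) ^ 4)"
      by (simp add: prod_power_distrib prod_dividef)
    also have "\<dots> \<le> (\<Prod>j<n. gaussian_weight T (z j))"
      using T gaussian_weight_ge by (intro prod_mono) auto
    finally show "1 / (K ^ n) ^ 4 \<le> (\<Prod>j<n. gaussian_weight T (z j))" .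
  qed (use n in \<open>auto simp: gaussian_weight_def\<close>)
  then have "real (card ?S) \<le> ((3 * T)\<^sup>2) ^ n * (K ^ n) ^ 4"
    using K by (simp add: field_simps)
  also have "\<dots> = ((3 * T)\<^sup>2 * K ^ 4) ^ n"
    by (simp add: power_mult_distrib power_mult[symmetric] mult.commute)
  also have "(3 * T)\<^sup>2 * K ^ 4 = (3 * K\<^sup>2 * T)\<^sup>2"
    by (simp add: power_mult_distrib power_mult[symmetric] mult_ac)
  also have "((3 * K\<^sup>2 * T)\<^sup>2) ^ n = (3 * K\<^sup>2 * T) ^ (2 * n)"
    by (simp only: power_mult)
  also have "K\<^sup>2 = exp (2 * (1 + recip p))"
    unfolding K_def by (rule exp_double[symmetric])
  finally show ?thesis .
qed

text \<open>
  At radius \<open>m\<^bsup>1/p\<^esup>\<close> with \<open>m \<le> n\<close> at most \<open>m\<close> entries of an integer vector are nonzero. The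
  weights therefore charge a factor \<open>m/n\<close> for each nonzero entry and nothing for a zero entry: the
  total weight \<open>(1 + 9m/n)\<^sup>n\<close> stays below \<open>e\<^bsup>9m\<^esup>\<close>, and a vector of the ball has weight at least
  \<open>(c m/n)\<^sup>m\<close>.
\<close>

lemma card_gaussian_vecs_sparse:
  assumes r: "0 < r" and n: "0 < n" and m: "0 < m" "m \<le> real n"
  shows "real (card {z \<in> gaussian_box n M. lp_norm (ereal r) (gaussian_vec n z) \<le> m powr (1 / r)})
    \<le> (exp (9 + 4 * (1 + 1 / r)) * real n / m) powr m"
proof -
  let ?D = "{-int M..int M} \<times> {-int M..int M}"
  let ?S = "{z \<in> gaussian_box n M. lp_norm (ereal r) (gaussian_vec n z) \<le> m powr (1 / r)}"
  define c where "c = 4 * (1 + 1 / r)"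
  define \<mu> where "\<mu> = m / real n"
  have \<mu>: "0 < \<mu>" "\<mu> \<le> 1" using m n by (auto simp: \<mu>_def)
  have c: "0 < c" using r by (simp add: c_def add_pos_pos)
  define w where "w = (\<lambda>d::int\<times>int. if d = (0,0) then 1 else \<mu> * gaussian_weight 1 d)"
  define \<theta> where "\<theta> = \<mu> * exp (- c)"
  have \<theta>: "0 < \<theta>" using \<mu> by (simp add: \<theta>_def)
  have "\<theta> \<le> 1 * 1" unfolding \<theta>_def using \<mu> c by (intro mult_mono) auto
  then have \<theta>1: "\<theta> \<le> 1" by simp
  have w0: "0 \<le> w d" for d using \<mu> by (auto simp: w_def gaussian_weight_def)
  have "\<theta> powr m * real (card ?S) \<le> (1 + 9 * \<mu>) ^ card {..<n}"
  proof (rule card_le_of_product_weights[where D = ?D and w = "\<lambda>_. w"])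
    show "?S \<subseteq> {..<n} \<rightarrow>\<^sub>E ?D"
      by (auto simp: gaussian_box_def)
    have "(\<Sum>d\<in>?D. w d) \<le> (\<Sum>d\<in>?D. (if d = (0,0) then 1 else 0) + \<mu> * gaussian_weight 1 d)"
      using \<mu> by (intro sum_mono) (auto simp: w_def gaussian_weight_def)
    also have "\<dots> = 1 + \<mu> * (\<Sum>d\<in>?D. gaussian_weight 1 d)"
      by (subst sum.distrib) (simp add: sum_distrib_left sum.delta)
    also have "\<dots> \<le> 1 + \<mu> * 9"
      using sum_gaussian_weight_le[of 1 M] \<mu> by (intro add_left_mono mult_left_mono) auto
    finally show "(\<Sum>d\<in>?D. w d) \<le> 1 + 9 * \<mu>" for j :: nat by (simp add: mult.commute)
    fix z assume z: "z \<in> ?S"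
    let ?c = "\<lambda>j. cmod (gaussian_vec n z $ j)"
    have entry: "\<theta> powr (?c j powr r) \<le> w (z j)" if j: "j < n" for j
    proof (cases "z j = (0,0)")
      case True
      then have "?c j = 0" using j by (simp add: gaussian_vec_def cmod_def)
      then show ?thesis using True \<theta> by (simp add: w_def)
    next
      case False
      \<comment> \<open>A nonzero Gaussian integer has modulus at least \<open>1\<close>, so a constant cost per nonzero entry
        can be charged to \<open>\<bar>z\<^sub>j\<bar>\<^sup>r\<close>.\<close>
      have "1 \<le> ?c j"
      proof -
        have "1 \<le> \<bar>real_of_int (fst (z j))\<bar> \<or> 1 \<le> \<bar>real_of_int (snd (z j))\<bar>"
          using False by (cases "z j") auto
        moreover have "\<bar>real_of_int (fst (z j))\<bar> \<le> ?c j" "\<bar>real_of_int (snd (z j))\<bar> \<le> ?c j"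
          using j abs_Re_le_cmod[of "gaussian_vec n z $ j"] abs_Im_le_cmod[of "gaussian_vec n z $ j"]
          by (auto simp: gaussian_vec_def)
        ultimately show ?thesis by linarith
      qed
      then have u: "1 \<le> ?c j powr r" using r by (simp add: ge_one_powr_ge_zero)
      have "1 + ?c j \<le> exp (1 + ?c j powr r / r)"
        using r by (intro one_plus_le_exp_powr) auto
      also have "\<dots> \<le> exp ((1 + 1 / r) * ?c j powr r)"
        using u by (simp add: algebra_simps)
      finally have "(1 + ?c j) ^ 4 \<le> exp ((1 + 1 / r) * ?c j powr r) ^ 4"
        by (intro power_mono) auto
      also have "\<dots> = exp (c * ?c j powr r)"
        by (simp add: exp_of_nat_mult[symmetric] c_def algebra_simps)
      finally have pow: "(1 + ?c j) ^ 4 \<le> exp (c * ?c j powr r)" .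
      have "\<theta> powr (?c j powr r) = \<mu> powr (?c j powr r) * exp (- (c * ?c j powr r))"
        using \<mu> by (simp add: \<theta>_def powr_mult exp_powr_real)
      also have "\<dots> \<le> \<mu> * exp (- (c * ?c j powr r))"
        using \<mu> u powr_mono'[of 1 "?c j powr r" \<mu>] by (intro mult_right_mono) auto
      also have "\<dots> = \<mu> * (1 / exp (c * ?c j powr r))"
        by (simp add: exp_minus inverse_eq_divide)
      also have "\<dots> \<le> \<mu> * (1 / (1 + ?c j) ^ 4)"
        using \<mu> pow by (intro mult_left_mono divide_left_mono mult_pos_pos zero_less_power)
          (auto intro: add_pos_nonneg)
      also have "\<dots> \<le> \<mu> * gaussian_weight 1 (z j)"
        using \<mu> gaussian_weight_ge[of 1 j n z] j by (intro mult_left_mono) auto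
      finally show ?thesis using False by (simp add: w_def)
    qed
    have "(\<Sum>j<n. ?c j powr r) \<le> m"
      using z r m lp_norm_finite_le_iff[of r "m powr (1 / r)" "gaussian_vec n z"]
      by (simp add: powr_powr)
    then have "\<theta> powr m \<le> \<theta> powr (\<Sum>j<n. ?c j powr r)"
      using \<theta> \<theta>1 by (intro powr_mono') auto
    also have "\<dots> = (\<Prod>j<n. \<theta> powr (?c j powr r))"
      using \<theta> by (simp add: powr_sum)
    also have "\<dots> \<le> (\<Prod>j<n. w (z j))"
      using entry by (intro prod_mono) auto
    finally show "\<theta> powr m \<le> (\<Prod>j<n. w (z j))" .
  qed (use n w0 in auto)
  also have "(1 + 9 * \<mu>) ^ card {..<n} \<le> exp (9 * \<mu>) ^ n"
    using \<mu> by (simp add: power_mono)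
  also have "\<dots> = exp 9 powr m"
    using n by (simp add: exp_of_nat_mult[symmetric] exp_powr_real \<mu>_def)
  finally have "real (card ?S) \<le> exp 9 powr m / \<theta> powr m"
    using \<theta> by (simp add: field_simps)
  also have "\<dots> = (exp 9 / \<theta>) powr m"
    using \<theta> by (simp add: powr_divide)
  also have "exp 9 / \<theta> = exp (9 + c) * real n / m"
    by (simp add: \<theta>_def \<mu>_def exp_add exp_minus field_simps)
  finally show ?thesis unfolding c_def .
qed

section \<open>Entropy numbers, coverings and packings\<close>

definition admissible_radii :: "nat \<Rightarrow> ereal \<Rightarrow> ereal \<Rightarrow> nat \<Rightarrow> real set" where
  "admissible_radii k p q n = {\<epsilon>. \<epsilon> > 0 \<and>
      (\<exists>y :: nat \<Rightarrow> complex vec. (\<forall>i \<in> {1..2 ^ (k - 1)}. y i \<in> carrier_vec n) \<and>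
        {x \<in> carrier_vec n. lp_norm p x \<le> 1} \<subseteq>
          (\<Union>i \<in> {1..2 ^ (k - 1)}.
            (\<lambda>z. y i + complex_of_real \<epsilon> \<cdot>\<^sub>v z) ` {x \<in> carrier_vec n. lp_norm q x \<le> 1}))}"

lemma entropy_number_eq:
  "entropy_number k (lp_space p n) (lp_space q n) id = Inf (admissible_radii k p q n)"
  by (simp add: entropy_number_def admissible_radii_def lp_space_def unit_cball_def)

text \<open>
  A cover by any nonempty set of at most \<open>2\<^bsup>k-1\<^esup>\<close> centres suffices, because centres may be
  repeated.
\<close>

lemma admissible_radiiI:
  assumes q: "0 < q" and n: "0 < n" and \<epsilon>: "0 < \<epsilon>"
    and F: "finite F" "F \<noteq> {}" "F \<subseteq> carrier_vec n" "card F \<le> 2 ^ (k - 1)"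
    and cover: "\<And>x. x \<in> carrier_vec n \<Longrightarrow> lp_norm p x \<le> 1 \<Longrightarrow> \<exists>y\<in>F. lp_norm q (x - y) \<le> \<epsilon>"
  shows "\<epsilon> \<in> admissible_radii k p q n"
proof -
  obtain h where h: "bij_betw h {1..card F} F"
    using ex_bij_betw_nat_finite_1[OF F(1)] by blast
  define y where "y i = (if i \<le> card F then h i else h 1)" for i
  have c1: "1 \<le> card F" using F by (simp add: Suc_leI card_gt_0_iff)
  have yF: "y i \<in> F" if "1 \<le> i" for i
    using h that c1 by (auto simp: y_def bij_betw_def)
  have "\<exists>i\<in>{1..2 ^ (k - 1)}. x \<in> (\<lambda>z. y i + complex_of_real \<epsilon> \<cdot>\<^sub>v z) ` {x \<in> carrier_vec n. lp_norm q x \<le> 1}"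
    if x: "x \<in> carrier_vec n" "lp_norm p x \<le> 1" for x
  proof -
    obtain v where v: "v \<in> F" "lp_norm q (x - v) \<le> \<epsilon>" using cover[OF x] by blast
    have "v \<in> h ` {1..card F}" using v(1) h by (simp add: bij_betw_imp_surj_on)
    then obtain i where i: "i \<in> {1..card F}" "h i = v" by (elim imageE) simp
    have vn: "v \<in> carrier_vec n" using v F by auto
    let ?z = "complex_of_real (1 / \<epsilon>) \<cdot>\<^sub>v (x - v)"
    have "lp_norm q ?z = (1 / \<epsilon>) * lp_norm q (x - v)"
      using q n x vn \<epsilon> by (subst lp_norm_smult) (auto simp: norm_divide)
    also have "\<dots> \<le> 1" using v \<epsilon> by (simp add: field_simps)
    finally have "lp_norm q ?z \<le> 1" .
    moreover have "?z \<in> carrier_vec n" using x vn by auto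
    moreover have "x = y i + complex_of_real \<epsilon> \<cdot>\<^sub>v ?z"
      using i x vn \<epsilon> by (intro eq_vecI) (auto simp: y_def)
    ultimately have "x \<in> (\<lambda>z. y i + complex_of_real \<epsilon> \<cdot>\<^sub>v z) ` {x \<in> carrier_vec n. lp_norm q x \<le> 1}"
      by (intro image_eqI[of _ _ ?z]) simp_all
    moreover have "i \<in> {1..2 ^ (k - 1)}" using i F by simp
    ultimately show ?thesis by (rule bexI)
  qed
  moreover have "\<forall>i\<in>{1..2 ^ (k - 1)}. y i \<in> carrier_vec n" using yF F by (meson atLeastAtMost_iff subsetD)
  ultimately show ?thesis
    unfolding admissible_radii_def using \<epsilon> by (simp add: subset_iff) blast
qed

lemma one_admissible:
  assumes "0 < p" "p \<le> q" "0 < n"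
  shows "1 \<in> admissible_radii k p q n"
proof (rule admissible_radiiI[where F = "{0\<^sub>v n}"])
  show "0 < q" using assms(1,2) by (rule less_le_trans)
  fix x :: "complex vec" assume x: "x \<in> carrier_vec n" "lp_norm p x \<le> 1"
  have "x - 0\<^sub>v n = x" using x by auto
  moreover have "lp_norm q x \<le> 1" using x assms(3) by (intro lp_norm_le_one_mono[OF assms(1,2)]) auto
  ultimately show "\<exists>y\<in>{0\<^sub>v n}. lp_norm q (x - y) \<le> 1" by simp
qed (use assms in auto)

lemma entropy_number_le:
  assumes "\<epsilon> \<in> admissible_radii k p q n"
  shows "entropy_number k (lp_space p n) (lp_space q n) id \<le> \<epsilon>"
  unfolding entropy_number_eq
  by (rule cInf_lower[OF assms]) (auto simp: admissible_radii_def bdd_below_def intro!: exI[of _ 0])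

text \<open>
  Pigeonhole. The number \<open>c\<close> bounds how many of the points \<open>f i\<close> can lie in one ball of radius
  at most \<open>r\<close>. With \<open>2\<^bsup>k-1\<^esup>\<close> such balls not all of the points can be covered. Points are counted
  by their indices.
\<close>

lemma entropy_number_ge_of_packing:
  fixes f :: "'i \<Rightarrow> complex vec"
  assumes p: "0 < p" "p \<le> q" and n: "0 < n"
    and I: "finite I" and f: "\<And>i. i \<in> I \<Longrightarrow> f i \<in> carrier_vec n" "\<And>i. i \<in> I \<Longrightarrow> lp_norm p (f i) \<le> 1"
    and close: "\<And>V. V \<subseteq> I \<Longrightarrow>
        (\<And>i j. i \<in> V \<Longrightarrow> j \<in> V \<Longrightarrow> lp_norm q (f i - f j) \<le> 2 powr (1 + recip q) * r) \<Longrightarrow>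
        real (card V) \<le> c"
    and c: "2 ^ (k - 1) * c < real (card I)"
  shows "r \<le> entropy_number k (lp_space p n) (lp_space q n) id"
  unfolding entropy_number_eq
proof (rule cInf_greatest)
  show "admissible_radii k p q n \<noteq> {}" using one_admissible[OF p n] by blast
  have q: "0 < q" using p by (rule less_le_trans)
  fix \<epsilon> assume "\<epsilon> \<in> admissible_radii k p q n"
  then obtain y :: "nat \<Rightarrow> complex vec" where \<epsilon>: "0 < \<epsilon>"
    and y: "\<forall>i \<in> {1..2 ^ (k - 1)}. y i \<in> carrier_vec n"
    and cover: "{x \<in> carrier_vec n. lp_norm p x \<le> 1} \<subseteq> (\<Union>i \<in> {1..2 ^ (k - 1)}.
            (\<lambda>z. y i + complex_of_real \<epsilon> \<cdot>\<^sub>v z) ` {x \<in> carrier_vec n. lp_norm q x \<le> 1})"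
    unfolding admissible_radii_def mem_Collect_eq by (elim conjE exE)
  define ball where "ball l = (\<lambda>z. y l + complex_of_real \<epsilon> \<cdot>\<^sub>v z) ` {x \<in> carrier_vec n. lp_norm q x \<le> 1}" for l
  define V where "V l = {i \<in> I. f i \<in> ball l}" for l
  show "r \<le> \<epsilon>"
  proof (rule ccontr)
    assume "\<not> r \<le> \<epsilon>"
    have "real (card (V l)) \<le> c" if l: "l \<in> {1..2 ^ (k - 1)}" for l
    proof (rule close)
      show "V l \<subseteq> I" by (auto simp: V_def)
      fix i j assume ij: "i \<in> V l" "j \<in> V l"
      obtain z w where z: "z \<in> carrier_vec n" "lp_norm q z \<le> 1" "f i = y l + complex_of_real \<epsilon> \<cdot>\<^sub>v z"
        and w: "w \<in> carrier_vec n" "lp_norm q w \<le> 1" "f j = y l + complex_of_real \<epsilon> \<cdot>\<^sub>v w"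
        using ij by (auto simp: V_def ball_def)
      have "f i - f j = complex_of_real \<epsilon> \<cdot>\<^sub>v (z - w)"
        using z w y[rule_format, OF l] by (intro eq_vecI) (auto simp: algebra_simps)
      then have "lp_norm q (f i - f j) = \<epsilon> * lp_norm q (z - w)"
        using q n z w \<epsilon> by (simp add: lp_norm_smult)
      also have "\<dots> \<le> \<epsilon> * (2 powr (1 + recip q) * 1)"
        using q n z w \<epsilon> by (intro mult_left_mono lp_norm_diff_le[where n = n]) auto
      also have "\<dots> \<le> 2 powr (1 + recip q) * r"
        using \<open>\<not> r \<le> \<epsilon>\<close> by simp
      finally show "lp_norm q (f i - f j) \<le> 2 powr (1 + recip q) * r" .
    qed
    then have "(\<Sum>l\<in>{1..2 ^ (k - 1)}. real (card (V l))) \<le> (\<Sum>l\<in>{1..(2::nat) ^ (k - 1)}. c)"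
      by (intro sum_mono) auto
    moreover have "card I \<le> (\<Sum>l\<in>{1..2 ^ (k - 1)}. card (V l))"
    proof -
      have "I \<subseteq> (\<Union>l\<in>{1..2 ^ (k - 1)}. V l)"
      proof
        fix i assume i: "i \<in> I"
        with f cover have "f i \<in> (\<Union>l \<in> {1..2 ^ (k - 1)}. ball l)"
          unfolding ball_def by blast
        with i show "i \<in> (\<Union>l\<in>{1..2 ^ (k - 1)}. V l)" by (auto simp: V_def)
      qed
      then have "card I \<le> card (\<Union>l\<in>{1..2 ^ (k - 1)}. V l)"
        using I by (intro card_mono) (auto simp: V_def)
      also have "\<dots> \<le> (\<Sum>l\<in>{1..2 ^ (k - 1)}. card (V l))"
        by (intro card_UN_le) auto
      finally show ?thesis .
    qed
    then have "real (card I) \<le> (\<Sum>l\<in>{1..2 ^ (k - 1)}. real (card (V l)))"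
      by (metis of_nat_le_iff of_nat_sum)
    ultimately show False using c by simp
  qed
qed

section \<open>Upper bounds by rounding to a lattice\<close>

definition toward_zero :: "real \<Rightarrow> int" where
  "toward_zero x = (if 0 \<le> x then \<lfloor>x\<rfloor> else \<lceil>x\<rceil>)"

lemma abs_toward_zero_le: "\<bar>real_of_int (toward_zero x)\<bar> \<le> \<bar>x\<bar>"
  and abs_diff_toward_zero_le: "\<bar>x - real_of_int (toward_zero x)\<bar> \<le> \<bar>x\<bar>"
  and abs_diff_toward_zero_le_one: "\<bar>x - real_of_int (toward_zero x)\<bar> \<le> 1"
proof -
  have "0 \<le> real_of_int (toward_zero x) \<and> real_of_int (toward_zero x) \<le> x \<and> x \<le> real_of_int (toward_zero x) + 1
     \<or> real_of_int (toward_zero x) \<le> 0 \<and> x \<le> real_of_int (toward_zero x) \<and> real_of_int (toward_zero x) \<le> x + 1"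
  proof (cases "0 \<le> x")
    case True
    then show ?thesis unfolding toward_zero_def by simp
  next
    case False
    then have "\<lceil>x\<rceil> \<le> 0" by (simp add: ceiling_le_iff)
    then have "real_of_int \<lceil>x\<rceil> \<le> 0" by simp
    then show ?thesis using False unfolding toward_zero_def by simp
  qed
  then show "\<bar>real_of_int (toward_zero x)\<bar> \<le> \<bar>x\<bar>" "\<bar>x - real_of_int (toward_zero x)\<bar> \<le> \<bar>x\<bar>"
    "\<bar>x - real_of_int (toward_zero x)\<bar> \<le> 1"
    by linarith+
qed

lemma cmod_mono:
  assumes "\<bar>Re z\<bar> \<le> \<bar>Re w\<bar>" "\<bar>Im z\<bar> \<le> \<bar>Im w\<bar>"
  shows "cmod z \<le> cmod w"
  unfolding cmod_def using assms by (intro real_sqrt_le_mono add_mono) (simp_all add: abs_le_square_iff)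

lemma lp_norm_mono:
  assumes p: "0 < p" and n: "dim_vec x = n" "dim_vec y = n" "0 < n"
    and le: "\<And>j. j < n \<Longrightarrow> cmod (x $ j) \<le> cmod (y $ j)"
  shows "lp_norm p x \<le> lp_norm p y"
  using p
proof (cases rule: pos_ereal_cases)
  case infinite
  have "cmod (x $ j) \<le> lp_norm p y" if "j < n" for j
    using le[OF that] cmod_le_lp_norm[OF p, of j y] that n by linarith
  then show ?thesis using infinite n lp_norm_infinity_le_iff[of x "lp_norm p y"] by simp
next
  case (finite r)
  then show ?thesis using n le
    by (auto simp: lp_norm_def intro!: powr_mono2 sum_mono sum_nonneg)
qed

text \<open>
  Rounding towards zero rather than to the nearest lattice point gives both properties needed
  here: the lattice points used stay in the ball of radius \<open>1/h\<close>, and the error is dominated by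
  \<open>x\<close> itself as well as by \<open>2h\<close>.
\<close>

lemma admissible_by_rounding:
  assumes p: "0 < p" "p \<le> q" and n: "0 < n" and h: "0 < h" and \<epsilon>: "0 < \<epsilon>"
    and count: "\<And>M. real (card {z \<in> gaussian_box n M. lp_norm p (gaussian_vec n z) \<le> 1 / h}) \<le> 2 ^ (k - 1)"
    and err: "\<And>d. d \<in> carrier_vec n \<Longrightarrow> lp_norm p d \<le> 1 \<Longrightarrow> (\<And>j. j < n \<Longrightarrow> cmod (d $ j) \<le> 2 * h) \<Longrightarrow>
        lp_norm q d \<le> \<epsilon>"
  shows "\<epsilon> \<in> admissible_radii k p q n"
proof -
  define M where "M = nat \<lceil>1 / h\<rceil>"
  let ?S = "{z \<in> gaussian_box n M. lp_norm p (gaussian_vec n z) \<le> 1 / h}"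
  let ?F = "(\<lambda>z. complex_of_real h \<cdot>\<^sub>v gaussian_vec n z) ` ?S"
  have S: "finite ?S" by (rule finite_subset[OF _ finite_gaussian_box[of n M]]) auto
  have q: "0 < q" using p by (rule less_le_trans)
  have approx: "\<exists>y\<in>?F. lp_norm q (x - y) \<le> \<epsilon>"
    if x: "x \<in> carrier_vec n" "lp_norm p x \<le> 1" for x
  proof -
    define z where "z = (\<lambda>j\<in>{..<n}. (toward_zero (Re (x $ j) / h), toward_zero (Im (x $ j) / h)))"
    have zj: "gaussian_vec n z $ j = Complex (toward_zero (Re (x $ j) / h)) (toward_zero (Im (x $ j) / h))" if "j < n" for j
      using that by (simp add: gaussian_vec_def z_def)
    have cx: "cmod (x $ j) \<le> 1" if "j < n" for j
      using cmod_le_lp_norm[OF p(1), of j x] x that by auto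
    have inM: "toward_zero (t / h) \<in> {-int M..int M}" if "\<bar>t\<bar> \<le> 1" for t
    proof -
      have "\<bar>real_of_int (toward_zero (t / h))\<bar> \<le> \<bar>t\<bar> / h"
        using abs_toward_zero_le[of "t / h"] h by simp
      also have "\<dots> \<le> 1 / h" using that h by (simp add: divide_right_mono)
      also have "\<dots> \<le> real M" unfolding M_def by linarith
      finally show ?thesis by auto
    qed
    have box: "z \<in> gaussian_box n M"
      unfolding gaussian_box_def z_def
    proof (rule restrict_PiE_iff[THEN iffD2], rule ballI)
      fix j assume "j \<in> {..<n}"
      then have "\<bar>Re (x $ j)\<bar> \<le> 1" "\<bar>Im (x $ j)\<bar> \<le> 1"
        using cx[of j] abs_Re_le_cmod[of "x $ j"] abs_Im_le_cmod[of "x $ j"] by auto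
      then show "(toward_zero (Re (x $ j) / h), toward_zero (Im (x $ j) / h)) \<in> {-int M..int M} \<times> {-int M..int M}"
        using inM by blast
    qed
    have "lp_norm p (gaussian_vec n z) \<le> lp_norm p (complex_of_real (1 / h) \<cdot>\<^sub>v x)"
    proof (rule lp_norm_mono[OF p(1), where n = n])
      fix j assume j: "j < n"
      show "cmod (gaussian_vec n z $ j) \<le> cmod ((complex_of_real (1 / h) \<cdot>\<^sub>v x) $ j)"
        unfolding zj[OF j] using j x h abs_toward_zero_le[of "Re (x $ j) / h"] abs_toward_zero_le[of "Im (x $ j) / h"]
        by (intro cmod_mono) (auto simp: Re_divide_of_real Im_divide_of_real)
    qed (use x n in auto)
    also have "\<dots> \<le> 1 / h"
      using p n x h by (simp add: lp_norm_smult norm_divide divide_right_mono)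
    finally have "z \<in> ?S" using box by simp
    let ?y = "complex_of_real h \<cdot>\<^sub>v gaussian_vec n z"
    let ?d = "x - ?y"
    have dj: "?d $ j = complex_of_real h *
        Complex (Re (x $ j) / h - toward_zero (Re (x $ j) / h)) (Im (x $ j) / h - toward_zero (Im (x $ j) / h))"
      if "j < n" for j
      using that x h by (simp add: zj complex_eq_iff algebra_simps)
    have d1: "cmod (?d $ j) \<le> cmod (x $ j)" if "j < n" for j
    proof -
      have "cmod (?d $ j) \<le> cmod (complex_of_real h * Complex (Re (x $ j) / h) (Im (x $ j) / h))"
        unfolding dj[OF that] norm_mult
        using abs_diff_toward_zero_le[of "Re (x $ j) / h"] abs_diff_toward_zero_le[of "Im (x $ j) / h"]
        by (intro mult_left_mono cmod_mono) simp_all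
      also have "complex_of_real h * Complex (Re (x $ j) / h) (Im (x $ j) / h) = x $ j"
        using h by (simp add: complex_eq_iff)
      finally show ?thesis .
    qed
    have d2: "cmod (?d $ j) \<le> 2 * h" if "j < n" for j
    proof -
      have "cmod (?d $ j) \<le> h * (1 + 1)"
        unfolding dj[OF that] norm_mult using h abs_diff_toward_zero_le_one
        by (intro mult_mono order.trans[OF cmod_le] add_mono) auto
      then show ?thesis by simp
    qed
    have "lp_norm q ?d \<le> \<epsilon>"
    proof (rule err)
      show "?d \<in> carrier_vec n" using x by auto
      have "lp_norm p ?d \<le> lp_norm p x"
        using p n x d1 by (intro lp_norm_mono[where n = n]) auto
      then show "lp_norm p ?d \<le> 1" using x by simp
    qed (use d2 in auto)
    with \<open>z \<in> ?S\<close> show ?thesis by blast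
  qed
  show ?thesis
  proof (rule admissible_radiiI[OF q n \<epsilon>])
    show "finite ?F" using S by blast
    have "lp_norm p (0\<^sub>v n) \<le> 0 * real n powr recip p"
      using lp_norm_le_of_bound[of p "0\<^sub>v n" 0] p n by simp
    then show "?F \<noteq> {}" using approx[of "0\<^sub>v n"] by auto
    show "?F \<subseteq> carrier_vec n" by auto
    have "card ?F \<le> card ?S" using S by (rule card_image_le)
    moreover have "card ?S \<le> 2 ^ (k - 1)" using count[of M]
      by (metis (mono_tags, lifting) of_nat_le_iff of_nat_numeral of_nat_power)
    ultimately show "card ?F \<le> 2 ^ (k - 1)" by linarith
  qed (use approx in auto)
qed

lemma entropy_number_le_one:
  assumes "0 < p" "p \<le> q" "0 < n"
  shows "entropy_number k (lp_space p n) (lp_space q n) id \<le> 1"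
  by (rule entropy_number_le[OF one_admissible[OF assms]])

text \<open>
  The mesh is \<open>h = D 2\<^bsup>-k/2n\<^esup> n\<^bsup>-1/p\<^esup>\<close>. With \<open>T = 1/(h n\<^bsup>1/p\<^esup>)\<close> the dense count is
  \<open>(D T / 2)\<^bsup>2n\<^esup> = 2\<^bsup>k-2n\<^esup>\<close>, and it applies as soon as \<open>T \<ge> 1\<close>, which is the assumption on \<open>D\<close>.
\<close>

lemma entropy_number_le_large:
  fixes D :: real
  assumes p: "0 < p" "p \<le> q" and n: "0 < n" and k: "0 < k"
    and D_def: "D = 6 * exp (2 * (1 + recip p))"
    and big: "D \<le> 2 powr (real k / (2 * real n))"
  shows "entropy_number k (lp_space p n) (lp_space q n) id
    \<le> 2 * D * 2 powr (- (real k / (2 * real n))) * real n powr (recip q - recip p)"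
proof (intro entropy_number_le admissible_by_rounding[where h = "D * 2 powr (- (real k / (2 * real n))) * real n powr (- recip p)"])
  let ?t = "2 powr (real k / (2 * real n))"
  let ?h = "D * 2 powr (- (real k / (2 * real n))) * real n powr (- recip p)"
  have D: "0 < D" by (simp add: D_def)
  have q: "0 < q" using p by (rule less_le_trans)
  show "0 < ?h" using D n by simp
  have h: "1 / ?h = (?t / D) * real n powr recip p"
    using D n by (simp add: powr_minus field_simps)
  show "real (card {z \<in> gaussian_box n M. lp_norm p (gaussian_vec n z) \<le> 1 / ?h}) \<le> 2 ^ (k - 1)" for M
  proof -
    have "real (card {z \<in> gaussian_box n M. lp_norm p (gaussian_vec n z) \<le> 1 / ?h})
        \<le> (3 * exp (2 * (1 + recip p)) * (?t / D)) ^ (2 * n)"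
      unfolding h using p n big D by (intro card_gaussian_vecs_dense) auto
    also have "3 * exp (2 * (1 + recip p)) * (?t / D) = ?t / 2"
      by (simp add: D_def)
    also have "(?t / 2) ^ (2 * n) = 2 ^ k / 2 ^ (2 * n)"
      using n by (simp add: power_divide powr_power powr_realpow)
    also have "\<dots> \<le> 2 ^ k / 2 ^ 1"
      using n by (intro divide_left_mono power_increasing) auto
    also have "\<dots> = 2 ^ (k - 1)"
      using k by (cases k) auto
    finally show ?thesis .
  qed
  fix d :: "complex vec"
  assume d: "d \<in> carrier_vec n" "\<And>j. j < n \<Longrightarrow> cmod (d $ j) \<le> 2 * ?h"
  have "lp_norm q d \<le> 2 * ?h * real (dim_vec d) powr recip q"
    using d n D by (intro lp_norm_le_of_bound[OF q]) auto
  also have "\<dots> = 2 * D * 2 powr (- (real k / (2 * real n))) * real n powr (recip q - recip p)"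
    using d by (simp add: powr_diff powr_minus field_simps)
  finally show "lp_norm q d \<le> 2 * D * 2 powr (- (real k / (2 * real n))) * real n powr (recip q - recip p)" .
qed (use assms in \<open>auto simp: D_def\<close>)

lemma two_mult_le_two_power: "0 < j \<Longrightarrow> 2 * j \<le> 2 ^ j" for j :: nat
proof (induction j)
  case (Suc j)
  then show ?case by (cases "j = 0") auto
qed simp

text \<open>
  Here \<open>m = c k'/L\<close> with \<open>L = log\<^sub>2 (1 + 2n/k')\<close> and mesh \<open>m\<^bsup>-1/p\<^esup>\<close>. Since \<open>n/m\<close> is at most a
  constant multiple of \<open>(1 + 2n/k')\<^sup>2\<close>, the logarithm of the sparse count \<open>(C\<^sub>0 n/m)\<^sup>m\<close> is of order
  \<open>m L = c k'\<close>, and it drops below \<open>k' - 1\<close> for small \<open>c\<close>. The number \<open>m\<close> is real: for \<open>m < 1\<close> only the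
  vector \<open>0\<close> is counted, and this is what happens for \<open>k'\<close> near \<open>log\<^sub>2 (2n)\<close>. The index \<open>k' \<le> k\<close> makes the
  estimate for \<open>k' = 2n\<close> available for all larger \<open>k\<close>.
\<close>

lemma entropy_number_le_medium:
  assumes p: "0 < p" "p \<le> q"
  obtains C where "0 < C" and
    "\<And>n k k'. 0 < k' \<Longrightarrow> k' \<le> 2 * n \<Longrightarrow> k' \<le> k \<Longrightarrow>
      entropy_number k (lp_space p n) (lp_space q n) id
        \<le> C * (1 / real k' * log 2 (1 + 2 * real n / real k')) powr (recip p - recip q)"
  using p(1)
proof (cases rule: pos_ereal_cases)
  case infinite
  show thesis
  proof (rule that[of 1])
    fix n k k' :: nat assume k: "0 < k'" "k' \<le> 2 * n"
    have "0 < log 2 (1 + 2 * real n / real k')"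
      using k by (subst zero_less_log_cancel_iff) (auto intro: add_pos_pos)
    then have "(1 / real k' * log 2 (1 + 2 * real n / real k')) powr (recip p - recip q) = 1"
      using infinite p k by simp
    then show "entropy_number k (lp_space p n) (lp_space q n) id
        \<le> 1 * (1 / real k' * log 2 (1 + 2 * real n / real k')) powr (recip p - recip q)"
      using entropy_number_le_one[OF p, of n k] k by simp
  qed simp
next
  case (finite r)
  define s where "s = recip p - recip q"
  have s: "0 \<le> s" using recip_antimono[OF p] by (simp add: s_def)
  define C\<^sub>0 where "C\<^sub>0 = exp (9 + 4 * (1 + 1 / r))"
  define j where "j = nat \<lceil>3 + log 2 C\<^sub>0\<rceil> + 1"
  \<comment> \<open>The dependence of the exponent on \<open>c = 1/(2 y)\<close> is \<open>c (const + log\<^sub>2 y)\<close>. For \<open>y = 2\<^sup>j\<close> it is at most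
    \<open>1/2\<close> once \<open>j\<close> exceeds the constant.\<close>
  define c :: real where "c = 1 / (2 * 2 ^ j)"
  have C\<^sub>0: "1 \<le> C\<^sub>0" using finite by (simp add: C\<^sub>0_def add_nonneg_nonneg)
  have j: "3 + log 2 C\<^sub>0 \<le> real j" "0 < j"
    unfolding j_def by linarith+
  have "real (2 * j) \<le> real (2 ^ j)"
    using two_mult_le_two_power[OF j(2)] by (rule of_nat_mono)
  then have j2: "2 * real j \<le> 2 ^ j" by simp
  have c: "0 < c" "c \<le> 1 / 2" by (auto simp: c_def divide_simps)
  define C where "C = 2 powr (r * s) * c powr (- s)"
  have "1 \<le> 2 powr (r * s)" using finite s by (intro ge_one_powr_ge_zero) auto
  moreover have "1 \<le> c powr (- s)"
    using c s powr_mono'[of "-s" 0 c] by simp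
  ultimately have C: "1 \<le> C"
    unfolding C_def using mult_mono[of 1 "2 powr (r * s)" 1 "c powr (- s)"] by simp
  show thesis
  proof (rule that[of C, folded s_def])
    show "0 < C" using C by simp
    fix n k k' :: nat assume k: "0 < k'" "k' \<le> 2 * n" "k' \<le> k"
    define x where "x = 2 * real n / real k'"
    define L where "L = log 2 (1 + x)"
    have n: "0 < n" using k by auto
    have x: "1 \<le> x" using k by (simp add: x_def)
    have "log 2 2 \<le> L"
      unfolding L_def using x by (subst log_le_cancel_iff) auto
    then have L: "1 \<le> L" by simp
    have L2: "L \<le> 2 * x"
    proof -
      have "L * ln 2 = ln (1 + x)" by (simp add: L_def log_def)
      also have "\<dots> \<le> x" using x by (intro ln_add_one_self_le_self) auto
      finally have "L * ln 2 \<le> x" .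
      moreover have "1 / 2 \<le> ln (2::real)"
        by (subst ln_ge_iff) (use exp_half_le2 in simp_all)
      then have "L * (1 / 2) \<le> L * ln 2"
        using L by (intro mult_left_mono) auto
      ultimately show ?thesis by simp
    qed
    show "entropy_number k (lp_space p n) (lp_space q n) id
        \<le> C * (1 / real k' * log 2 (1 + 2 * real n / real k')) powr s"
    \<comment> \<open>The count \<open>2\<^bsup>k'/2\<^esup>\<close> fits only if \<open>k'/2 \<le> k' - 1\<close>, which fails at \<open>k' = 1\<close>. There the right-hand
      side is at least \<open>1\<close>.\<close>
    proof (cases "k' = 1")
      case True
      have "1 * 1 \<le> C * L powr s"
        using C L s by (intro mult_mono ge_one_powr_ge_zero) auto
      then show ?thesis
        using entropy_number_le_one[OF p n, of k] True by (simp add: L_def x_def)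
    next
      case False
      then have k2: "2 \<le> k'" using k by simp
      define m where "m = c * real k' / L"
      have m0: "0 < m" using c k L by (simp add: m_def)
      have "m \<le> c * real k'"
        using c k L by (simp add: m_def field_simps mult_left_mono)
      also have "\<dots> \<le> 1 / 2 * real (2 * n)"
        using c k by (intro mult_mono) auto
      finally have mn: "m \<le> real n" by simp
      have nm: "C\<^sub>0 * real n / m = C\<^sub>0 * 2 ^ j * (x * L)"
        using k L by (simp add: m_def x_def c_def field_simps)
      have "x * L \<le> (1 + x) * (2 * (1 + x))"
        using x L L2 by (intro mult_mono) auto
      then have "C\<^sub>0 * real n / m \<le> C\<^sub>0 * 2 ^ j * ((1 + x) * (2 * (1 + x)))"
        unfolding nm using C\<^sub>0 by (intro mult_left_mono) auto
      then have "log 2 (C\<^sub>0 * real n / m) \<le> log 2 (C\<^sub>0 * 2 ^ j * ((1 + x) * (2 * (1 + x))))"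
        using C\<^sub>0 m0 n x by (subst log_le_cancel_iff) auto
      also have "\<dots> = log 2 C\<^sub>0 + real j + 1 + 2 * L"
        using C\<^sub>0 x by (simp add: log_mult L_def log_nat_power del: distrib_left_numeral)
      also have "\<dots> \<le> 2 * real j * L"
      proof -
        have "(log 2 C\<^sub>0 + real j + 1) * 1 \<le> (log 2 C\<^sub>0 + real j + 1) * L"
          using C\<^sub>0 L by (intro mult_left_mono) auto
        moreover have "(log 2 C\<^sub>0 + real j + 1 + 2) * L \<le> (2 * real j) * L"
          using j L by (intro mult_right_mono) auto
        ultimately show ?thesis by (simp add: algebra_simps)
      qed
      also have "\<dots> \<le> 2 ^ j * L" using j2 L by (intro mult_right_mono) auto
      finally have "m * log 2 (C\<^sub>0 * real n / m) \<le> m * (2 ^ j * L)"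
        using m0 by (intro mult_left_mono) auto
      also have "\<dots> = real k' / 2" using L by (simp add: m_def c_def)
      also have "\<dots> \<le> real (k - 1)" using k k2 by simp
      finally have expo: "m * log 2 (C\<^sub>0 * real n / m) \<le> real (k - 1)" .
      have B: "0 < C\<^sub>0 * real n / m" using C\<^sub>0 n m0 by simp
      define h where "h = m powr (- 1 / r)"
      have h: "0 < h" "1 / h = m powr (1 / r)"
        using m0 by (auto simp: h_def powr_minus_divide)
      show ?thesis
      proof (rule entropy_number_le, rule admissible_by_rounding[OF p n h(1)])
        fix M
        have "real (card {z \<in> gaussian_box n M. lp_norm p (gaussian_vec n z) \<le> 1 / h})
            \<le> (C\<^sub>0 * real n / m) powr m"
          unfolding h finite(1) C\<^sub>0_def using finite n m0 mn by (intro card_gaussian_vecs_sparse)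
        also have "\<dots> = 2 powr (m * log 2 (C\<^sub>0 * real n / m))"
          using B by (simp add: powr_powr[symmetric] mult.commute[of m])
        also have "\<dots> \<le> 2 powr real (k - 1)" using expo by simp
        also have "\<dots> = 2 ^ (k - 1)" by (rule powr_realpow) simp
        finally show "real (card {z \<in> gaussian_box n M. lp_norm p (gaussian_vec n z) \<le> 1 / h}) \<le> 2 ^ (k - 1)" .
      next
        show "0 < C * (1 / real k' * log 2 (1 + 2 * real n / real k')) powr s"
          using C L k by (simp add: L_def x_def)
        fix d :: "complex vec"
        assume d: "d \<in> carrier_vec n" "lp_norm p d \<le> 1" "\<And>j. j < n \<Longrightarrow> cmod (d $ j) \<le> 2 * h"
        have "lp_norm q d \<le> (2 * h) powr (r * (recip p - recip q))"
          using p finite(1) h n d by (intro lp_norm_interpolate[of p r q]) auto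
        also have "\<dots> = 2 powr (r * s) * m powr (- s)"
          unfolding s_def[symmetric] using h finite(2) m0 by (simp add: powr_mult h_def powr_powr)
        also have "m powr (- s) = c powr (- s) * (1 / real k' * L) powr s"
        proof -
          have "m powr (- s) = (c * (real k' / L)) powr (- s)" by (simp add: m_def)
          also have "\<dots> = c powr (- s) * (real k' / L) powr (- s)"
            by (rule powr_mult)
          also have "(real k' / L) powr (- s) = (1 / real k' * L) powr s"
            using k L by (simp add: powr_minus powr_divide)
          finally show ?thesis .
        qed
        finally show "lp_norm q d \<le> C * (1 / real k' * log 2 (1 + 2 * real n / real k')) powr s"
          by (simp add: C_def L_def x_def mult.assoc)
      qed
    qed
  qed
qed

section \<open>Lower bounds by packings\<close>

lemma entropy_number_ge_small:
  assumes p: "0 < p" "p \<le> q" and n: "0 < n" and k: "2 ^ (k - 1) \<le> n"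
  shows "1 / (2 * 2 powr (1 + recip q)) \<le> entropy_number k (lp_space p n) (lp_space q n) id"
proof -
  have q: "0 < q" using p by (rule less_le_trans)
  define f :: "nat \<Rightarrow> complex vec" where "f i = vec n (\<lambda>j. if j = i then 1 else 0)" for i
  show ?thesis
  proof (rule entropy_number_ge_of_packing[OF p n, where I = "{..n}" and f = f and c = 1])
    fix i assume "i \<in> {..n}"
    show "f i \<in> carrier_vec n" by (simp add: f_def)
    have "{j. j < n \<and> f i $ j \<noteq> 0} \<subseteq> {i}" by (auto simp: f_def split: if_splits)
    then have "card {j. j < n \<and> f i $ j \<noteq> 0} \<le> card {i}" by (intro card_mono) auto
    then have "lp_norm p (f i) \<le> 1 * 1 powr recip p"
      using p n by (intro lp_norm_le_of_support) (auto simp: f_def)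
    then show "lp_norm p (f i) \<le> 1" by simp
  next
    fix V assume V: "V \<subseteq> {..n}"
      and close: "\<And>i j. i \<in> V \<Longrightarrow> j \<in> V \<Longrightarrow>
        lp_norm q (f i - f j) \<le> 2 powr (1 + recip q) * (1 / (2 * 2 powr (1 + recip q)))"
    have False if ij: "i \<in> V" "j \<in> V" "i < j" for i j
    proof -
      have "i < n" using V ij by auto
      then have "1 * real (card {i}) powr recip q \<le> lp_norm q (f i - f j)"
        using q ij by (intro lp_norm_ge_of_large_entries) (auto simp: f_def)
      also have "\<dots> \<le> 1 / 2" using close[OF ij(1,2)] by simp
      finally show False by simp
    qed
    then have "\<exists>i. V \<subseteq> {i}"
      by (metis insert_iff linorder_neqE_nat subsetI)
    then show "real (card V) \<le> 1"
      by (metis card.empty card_1_singleton_iff finite.emptyI le_numeral_extra(4) of_nat_0 of_nat_1 One_nat_def subset_singleton_iff zero_le_one)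
  next
    have "2 ^ (k - 1) < n + 1" using k by simp
    then have "real (2 ^ (k - 1)) < real (n + 1)" by (rule of_nat_less_iff[THEN iffD2])
    then show "2 ^ (k - 1) * 1 < real (card {..n})" by simp
  qed auto
qed

text \<open>
  Subtracting one of the points moves all of them into a ball centred at the origin, where the
  dense count with \<open>T = 1\<close> applies.
\<close>

lemma card_pairwise_close_grid_points:
  assumes q: "0 < q" and n: "0 < n"
    and V: "V \<subseteq> Pi\<^sub>E {..<n} (\<lambda>_. {0..int M} \<times> {0..int M})"
    and close: "\<And>v w. v \<in> V \<Longrightarrow> w \<in> V \<Longrightarrow>
      lp_norm q (gaussian_vec n v - gaussian_vec n w) \<le> real n powr recip q"
  shows "real (card V) \<le> (3 * exp (2 * (1 + recip q))) ^ (2 * n)"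
proof (cases "V = {}")
  case False
  then obtain w where w: "w \<in> V" by blast
  define g where "g v = (\<lambda>j\<in>{..<n}. (fst (v j) - fst (w j), snd (v j) - snd (w j)))" for v
  let ?S = "{z \<in> gaussian_box n M. lp_norm q (gaussian_vec n z) \<le> 1 * real n powr recip q}"
  have "g ` V \<subseteq> ?S"
  proof (rule image_subsetI)
    fix v assume v: "v \<in> V"
    have "v j \<in> {0..int M} \<times> {0..int M}" "w j \<in> {0..int M} \<times> {0..int M}" if "j < n" for j
      using V v w that by (auto simp: PiE_iff)
    then have "(fst (v j) - fst (w j), snd (v j) - snd (w j)) \<in> {-int M..int M} \<times> {-int M..int M}"
      if "j < n" for j
      using that by (fastforce simp: mem_Times_iff)
    then have "g v \<in> gaussian_box n M"
      unfolding gaussian_box_def g_def by (simp add: restrict_PiE_iff)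
    moreover have "gaussian_vec n (g v) = gaussian_vec n v - gaussian_vec n w"
      by (intro eq_vecI) (auto simp: gaussian_vec_def g_def complex_eq_iff)
    ultimately show "g v \<in> ?S" using close[OF v w] by simp
  qed
  moreover have "inj_on g V"
  proof (rule inj_onI)
    fix u v assume uv: "u \<in> V" "v \<in> V" "g u = g v"
    show "u = v"
    proof (rule PiE_ext)
      show "u \<in> Pi\<^sub>E {..<n} (\<lambda>_. {0..int M} \<times> {0..int M})" "v \<in> Pi\<^sub>E {..<n} (\<lambda>_. {0..int M} \<times> {0..int M})"
        using uv V by auto
      fix j assume "j \<in> {..<n}"
      then show "u j = v j"
        using fun_cong[OF uv(3), of j] by (auto simp: g_def prod_eq_iff)
    qed
  qed
  ultimately have "card V \<le> card ?S"
    by (intro card_inj_on_le) auto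
  also have "real (card ?S) \<le> (3 * exp (2 * (1 + recip q)) * 1) ^ (2 * n)"
    by (rule card_gaussian_vecs_dense[OF q n]) simp
  finally show ?thesis by simp
qed simp

text \<open>
  The grid has \<open>(M+1)\<^bsup>2n\<^esup>\<close> points and spacing \<open>\<delta>\<close> of order \<open>n\<^bsup>-1/p\<^esup>/M\<close>. A ball of radius of order
  \<open>\<delta> n\<^bsup>1/q\<^esup>\<close> contains at most \<open>G\<^bsup>2n\<^esup>\<close> of them, so \<open>M\<close> is taken just large enough, of order
  \<open>2\<^bsup>k/2n\<^esup>\<close>, for \<open>2\<^bsup>k-1\<^esup>\<close> balls to be too few.
\<close>

lemma entropy_number_ge_dense:
  assumes p: "0 < p" "p \<le> q"
  obtains c where "0 < c" and
    "\<And>n k. 0 < n \<Longrightarrow> 0 < k \<Longrightarrow>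
      c * 2 powr (- (real k / (2 * real n))) * real n powr (recip q - recip p)
        \<le> entropy_number k (lp_space p n) (lp_space q n) id"
proof -
  have q: "0 < q" using p by (rule less_le_trans)
  define G where "G = 3 * exp (2 * (1 + recip q))"
  define K where "K = 2 powr (1 + recip q)"
  have K: "0 < K" by (simp add: K_def)
  have "1 * 1 \<le> G"
    unfolding G_def using recip_nonneg[OF q] by (intro mult_mono) auto
  then have G: "1 \<le> G" by simp
  show thesis
  proof (rule that[of "1 / (4 * G * K)"])
    show "0 < 1 / (4 * G * K)" using G K by simp
    fix n k :: nat assume n: "0 < n" and k: "0 < k"
    define t where "t = 2 powr (real k / (2 * real n))"
    have t: "1 \<le> t" by (simp add: t_def ge_one_powr_ge_zero)
    define M where "M = nat \<lceil>G * t\<rceil>"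
    have Gt: "1 \<le> G * t" using mult_mono[of 1 G 1 t] G t by simp
    have M: "G * t \<le> real M" "real M \<le> 2 * (G * t)" unfolding M_def using Gt by linarith+
    then have M0: "0 < real M" using Gt by linarith
    define \<delta> where "\<delta> = real n powr (- recip p) / (2 * real M)"
    have \<delta>: "0 < \<delta>" using n M0 by (simp add: \<delta>_def)
    define I where "I = Pi\<^sub>E {..<n} (\<lambda>_. {0..int M} \<times> {0..int M})"
    define f where "f v = complex_of_real \<delta> \<cdot>\<^sub>v gaussian_vec n v" for v
    define r where "r = \<delta> * real n powr recip q / K"
    have "r \<le> entropy_number k (lp_space p n) (lp_space q n) id"
    proof (rule entropy_number_ge_of_packing[OF p n, where I = I and f = f and c = "G ^ (2 * n)"])
      show "finite I" unfolding I_def by (intro finite_PiE) auto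
      fix v assume v: "v \<in> I"
      show "f v \<in> carrier_vec n" by (simp add: f_def)
      have "cmod (gaussian_vec n v $ j) \<le> 2 * real M" if j: "j < n" for j
      proof -
        have "v j \<in> {0..int M} \<times> {0..int M}" using v j by (auto simp: I_def PiE_iff)
        then have "\<bar>real_of_int (fst (v j))\<bar> \<le> real M" "\<bar>real_of_int (snd (v j))\<bar> \<le> real M"
          by (auto simp: mem_Times_iff)
        then show ?thesis
          using cmod_le[of "gaussian_vec n v $ j"] j by (simp add: gaussian_vec_def)
      qed
      then have "lp_norm p (gaussian_vec n v) \<le> 2 * real M * real n powr recip p"
        using lp_norm_le_of_bound[OF p(1), of "gaussian_vec n v" "2 * real M"] n by simp
      then have "\<delta> * lp_norm p (gaussian_vec n v) \<le> \<delta> * (2 * real M * real n powr recip p)"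
        using \<delta> by (intro mult_left_mono) auto
      also have "\<dots> = 1" using n M0 by (simp add: \<delta>_def powr_minus)
      finally show "lp_norm p (f v) \<le> 1"
        using p n \<delta> by (simp add: f_def lp_norm_smult)
    next
      fix V assume V: "V \<subseteq> I"
        and close: "\<And>v w. v \<in> V \<Longrightarrow> w \<in> V \<Longrightarrow> lp_norm q (f v - f w) \<le> 2 powr (1 + recip q) * r"
      show "real (card V) \<le> G ^ (2 * n)"
        unfolding G_def
      proof (rule card_pairwise_close_grid_points[OF q n])
        show "V \<subseteq> Pi\<^sub>E {..<n} (\<lambda>_. {0..int M} \<times> {0..int M})" using V by (simp add: I_def)
        fix v w assume vw: "v \<in> V" "w \<in> V"
        have "f v - f w = complex_of_real \<delta> \<cdot>\<^sub>v (gaussian_vec n v - gaussian_vec n w)"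
          unfolding f_def by (intro eq_vecI) (auto simp: algebra_simps)
        then have "lp_norm q (f v - f w) = \<delta> * lp_norm q (gaussian_vec n v - gaussian_vec n w)"
          using q n \<delta> by (simp add: lp_norm_smult)
        moreover have "2 powr (1 + recip q) * r = \<delta> * real n powr recip q"
          using K by (simp add: r_def K_def)
        ultimately show "lp_norm q (gaussian_vec n v - gaussian_vec n w) \<le> real n powr recip q"
          using close[OF vw] \<delta> by simp
      qed
    next
      have "2 ^ (k - 1) * G ^ (2 * n) < 2 ^ k * G ^ (2 * n)"
        using k G by (intro mult_strict_right_mono power_strict_increasing) auto
      also have "(2::real) ^ k = t ^ (2 * n)"
        using n by (simp add: t_def powr_power powr_realpow)
      also have "t ^ (2 * n) * G ^ (2 * n) = (G * t) ^ (2 * n)"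
        by (simp add: power_mult_distrib)
      also have "\<dots> \<le> (real M + 1) ^ (2 * n)"
        using M Gt by (intro power_mono) auto
      also have "\<dots> = real (card I)"
        by (simp add: I_def card_PiE power_mult power2_eq_square)
      finally show "2 ^ (k - 1) * G ^ (2 * n) < real (card I)" .
    qed
    moreover have "1 / (4 * G * K) * 2 powr (- (real k / (2 * real n))) * real n powr (recip q - recip p) \<le> r"
    proof -
      have "r = real n powr (recip q - recip p) / (2 * K) * (1 / real M)"
        by (simp add: r_def \<delta>_def powr_diff powr_minus field_simps)
      also have "\<dots> \<ge> real n powr (recip q - recip p) / (2 * K) * (1 / (2 * (G * t)))"
        using M M0 K G t by (intro mult_left_mono divide_left_mono mult_pos_pos) auto
      also have "real n powr (recip q - recip p) / (2 * K) * (1 / (2 * (G * t)))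
          = 1 / (4 * G * K) * 2 powr (- (real k / (2 * real n))) * real n powr (recip q - recip p)"
        by (simp add: t_def powr_minus field_simps)
      finally show ?thesis .
    qed
    ultimately show "1 / (4 * G * K) * 2 powr (- (real k / (2 * real n))) * real n powr (recip q - recip p)
        \<le> entropy_number k (lp_space p n) (lp_space q n) id"
      by linarith
  qed
qed

text \<open>
  Weight \<open>1\<close> for agreement with \<open>u\<close> and \<open>1/B\<close> for each of the other letters gives every
  coordinate total weight at most \<open>2\<close>.
\<close>

lemma card_hamming_ball_le:
  assumes B: "0 < B" and u: "u \<in> Pi\<^sub>E {..<m} (\<lambda>_. {..<B})"
    and V: "V \<subseteq> Pi\<^sub>E {..<m} (\<lambda>_. {..<B})"
    and close: "\<And>v. v \<in> V \<Longrightarrow> real (card {j. j < m \<and> v j \<noteq> u j}) \<le> t"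
  shows "real (card V) \<le> 2 ^ m * real B powr t"
proof -
  define w where "w j d = (if d = u j then 1 else 1 / real B)" for j :: nat and d :: nat
  have "real B powr (- t) * real (card V) \<le> 2 ^ card {..<m}"
  proof (rule card_le_of_product_weights[where D = "{..<B}" and w = w])
    fix j assume "j \<in> {..<m}"
    have "(\<Sum>d<B. w j d) \<le> (\<Sum>d<B. (if d = u j then 1 else 0) + 1 / real B)"
      by (intro sum_mono) (auto simp: w_def)
    also have "\<dots> = (\<Sum>d<B. if d = u j then 1 else 0) + 1"
      using B by (simp add: sum.distrib)
    also have "\<dots> \<le> 2" by (simp add: sum.delta')
    finally show "(\<Sum>d<B. w j d) \<le> 2" .
  next
    fix v assume v: "v \<in> V"
    let ?J = "{j. j < m \<and> v j \<noteq> u j}"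
    have "real B powr (- t) \<le> real B powr (- real (card ?J))"
      using close[OF v] B by (intro powr_mono) auto
    also have "\<dots> = (\<Prod>j\<in>?J. w j (v j))"
      using B by (simp add: w_def powr_minus powr_realpow power_one_over inverse_eq_divide)
    also have "\<dots> = (\<Prod>j<m. w j (v j))"
      by (intro prod.mono_neutral_left) (auto simp: w_def)
    finally show "real B powr (- t) \<le> (\<Prod>j<m. w j (v j))" .
  qed (use V in \<open>auto simp: w_def\<close>)
  then show ?thesis using B by (simp add: powr_minus field_simps)
qed

text \<open>
  The word \<open>v\<close> is turned into the vector with entry \<open>m\<^bsup>-1/p\<^esup>\<close> at position \<open>v j\<close> of the \<open>j\<close>-th block.
  Words that differ in more than \<open>m/2\<close> letters have distance at least \<open>m\<^bsup>-1/p\<^esup> (m/2)\<^bsup>1/q\<^esup>\<close>.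
  Phrased with more than \<open>m/2\<close> letters, rather than with a minimal distance, this also covers
  \<open>q = \<infinity>\<close>, where one differing letter is enough.
\<close>

lemma entropy_number_ge_of_code:
  assumes p: "0 < p" "p \<le> q" and m: "0 < m" and B: "0 < B" and mB: "m * B \<le> n"
    and k: "2 ^ (k - 1) * (2 ^ m * real B powr (real m / 2)) < real B ^ m"
  shows "real m powr (recip q - recip p) / (2 powr (recip q + 1) * 2 powr (1 + recip q))
    \<le> entropy_number k (lp_space p n) (lp_space q n) id"
proof -
  have q: "0 < q" using p by (rule less_le_trans)
  have n: "0 < n" using m B mB by (metis mult_pos_pos less_le_trans)
  define a where "a = real m powr (- recip p)"
  have a: "0 < a" using m by (simp add: a_def)
  define I where "I = Pi\<^sub>E {..<m} (\<lambda>_. {..<B})"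
  define f where "f v = vec n (\<lambda>l. if l div B < m \<and> v (l div B) = l mod B then complex_of_real a else 0)" for v
  define pos where "pos v j = j * B + v j" for v :: "nat \<Rightarrow> nat" and j
  define r where "r = a * (real m / 2) powr recip q / (2 * 2 powr (1 + recip q))"
  have pos: "pos v j < n" "pos v j div B = j" "pos v j mod B = v j" if "v \<in> I" "j < m" for v j
  proof -
    have vj: "v j < B" using that by (auto simp: I_def PiE_iff)
    then show "pos v j div B = j" "pos v j mod B = v j" by (auto simp: pos_def)
    have "j * B + v j < (j + 1) * B" using vj by simp
    also have "\<dots> \<le> m * B" using that by (intro mult_right_mono) auto
    finally show "pos v j < n" using mB by (simp add: pos_def)
  qed
  have inj: "inj_on (pos v) {..<m}" if "v \<in> I" for v
    by (rule inj_on_inverseI[where g = "\<lambda>l. l div B"]) (use pos that in auto)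
  have "r \<le> entropy_number k (lp_space p n) (lp_space q n) id"
  proof (rule entropy_number_ge_of_packing[OF p n, where I = I and f = f
        and c = "2 ^ m * real B powr (real m / 2)"])
    show "finite I" unfolding I_def by (intro finite_PiE) auto
    fix v assume v: "v \<in> I"
    show "f v \<in> carrier_vec n" by (simp add: f_def)
    have "{l. l < n \<and> f v $ l \<noteq> 0} \<subseteq> pos v ` {..<m}"
    proof
      fix l assume "l \<in> {l. l < n \<and> f v $ l \<noteq> 0}"
      then have "l div B < m" "v (l div B) = l mod B" by (auto simp: f_def split: if_splits)
      then show "l \<in> pos v ` {..<m}" by (intro image_eqI[of _ _ "l div B"]) (auto simp: pos_def)
    qed
    then have "card {l. l < n \<and> f v $ l \<noteq> 0} \<le> card (pos v ` {..<m})"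
      by (intro card_mono) auto
    also have "\<dots> \<le> m" using card_image_le[of "{..<m}" "pos v"] by simp
    finally have "lp_norm p (f v) \<le> a * real m powr recip p"
      using p n m a by (intro lp_norm_le_of_support) (auto simp: f_def)
    also have "\<dots> = 1" using m by (simp add: a_def powr_minus)
    finally show "lp_norm p (f v) \<le> 1" .
  next
    fix V assume V: "V \<subseteq> I"
      and close: "\<And>v w. v \<in> V \<Longrightarrow> w \<in> V \<Longrightarrow> lp_norm q (f v - f w) \<le> 2 powr (1 + recip q) * r"
    show "real (card V) \<le> 2 ^ m * real B powr (real m / 2)"
    proof (cases "V = {}")
      case False
      then obtain u where u: "u \<in> V" by blast
      have "real (card {j. j < m \<and> v j \<noteq> u j}) \<le> real m / 2" if v: "v \<in> V" for v
      proof (rule ccontr)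
        let ?J = "{j. j < m \<and> v j \<noteq> u j}"
        assume "\<not> real (card ?J) \<le> real m / 2"
        then have J: "real m / 2 < real (card ?J)" by simp
        have vI: "v \<in> I" and uI: "u \<in> I" using V v u by auto
        have cJ: "card (pos v ` ?J) = card ?J"
          by (intro card_image inj_on_subset[OF inj[OF vI]]) auto
        have "?J \<noteq> {}" using J m by (metis card.empty divide_pos_pos of_nat_0 of_nat_0_less_iff order_less_asym zero_less_numeral)
        then have "a * real (card (pos v ` ?J)) powr recip q \<le> lp_norm q (f v - f u)"
          using a pos[OF vI]
          by (intro lp_norm_ge_of_large_entries[OF q]) (auto simp: f_def)
        also have "\<dots> \<le> a * (real m / 2) powr recip q / 2"
          using close[OF v u] by (simp add: r_def)
        also have "\<dots> < a * (real m / 2) powr recip q"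
          using a m by simp
        also have "\<dots> \<le> a * real (card ?J) powr recip q"
          using a J recip_nonneg[OF q] by (intro mult_left_mono powr_mono2) auto
        finally show False by (simp add: cJ)
      qed
      then show ?thesis
        using V u by (intro card_hamming_ball_le[OF B, of u]) (auto simp: I_def)
    qed simp
  next
    show "2 ^ (k - 1) * (2 ^ m * real B powr (real m / 2)) < real (card I)"
      using k by (simp add: I_def card_PiE)
  qed
  also have "r = real m powr (recip q - recip p) / (2 powr (recip q + 1) * 2 powr (1 + recip q))"
    using m by (simp add: r_def a_def powr_divide powr_diff powr_minus powr_add field_simps)
  finally show ?thesis .
qed

text \<open>
  The code is used with \<open>m\<close> of order \<open>k/L\<close> blocks, where \<open>L = log\<^sub>2 (1 + 2n/k)\<close>. The block size is
  then at least a multiple of \<open>x = 2n/k\<close>. For large \<open>x\<close> this multiple exceeds \<open>4 (1 + x)\<^bsup>1/2\<^esup>\<close>, so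
  that \<open>(B/4)\<^bsup>m/2\<^esup> \<ge> 2\<^bsup>mL/4\<^esup> \<ge> 2\<^sup>k\<close>. The condition \<open>log\<^sub>2 (2n) \<le> k\<close> gives \<open>L \<le> 2k\<close>, so rounding \<open>m\<close> up
  to an integer changes its order only by a constant.
\<close>

lemma entropy_number_ge_sparse:
  assumes p: "0 < p" "p \<le> q" and n: "0 < n" and k: "0 < k"
    and log_le: "log 2 (2 * real n) \<le> real k" and k_small: "10000 * real k \<le> 2 * real n"
  shows "1 / (6 powr (recip p - recip q) * (2 powr (recip q + 1) * 2 powr (1 + recip q)))
      * (1 / real k * log 2 (1 + 2 * real n / real k)) powr (recip p - recip q)
    \<le> entropy_number k (lp_space p n) (lp_space q n) id"
proof -
  define s where "s = recip p - recip q"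
  have s: "0 \<le> s" using recip_antimono[OF p] by (simp add: s_def)
  define x where "x = 2 * real n / real k"
  define L where "L = log 2 (1 + x)"
  have x: "10000 \<le> x" using k k_small by (simp add: x_def field_simps)
  have "log 2 2 \<le> L"
    unfolding L_def using x by (subst log_le_cancel_iff) auto
  then have L: "1 \<le> L" by simp
  have Lk: "L \<le> 2 * real k"
  proof -
    have "x \<le> 2 * real n / 1" unfolding x_def using k by (intro divide_left_mono) auto
    then have "L \<le> log 2 (2 * (2 * real n))"
      unfolding L_def using x n by (subst log_le_cancel_iff) auto
    also have "\<dots> = 1 + log 2 (2 * real n)" using n by (subst log_mult) auto
    finally show ?thesis using log_le k by linarith
  qed
  define m where "m = nat \<lceil>4 * real k / L\<rceil>"
  have kL: "0 < 4 * real k / L" using k L by simp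
  have m: "4 * real k / L \<le> real m" "real m \<le> 4 * real k / L + 1"
    unfolding m_def using kL by linarith+
  have m6: "real m \<le> 6 * real k / L"
  proof -
    have "1 \<le> 2 * real k / L" using Lk L by simp
    then show ?thesis using m by (simp add: field_simps) argo
  qed
  have m0: "0 < m" using m kL by linarith
  define B where "B = n div m"
  have xm: "x / 12 \<le> real n / real m"
  proof -
    have "x / 12 * real m \<le> x / 12 * (6 * real k / L)"
      using m6 x by (intro mult_left_mono) auto
    also have "\<dots> = real n / L" using k by (simp add: x_def)
    also have "\<dots> \<le> real n / 1" using L by (intro divide_left_mono) auto
    finally show ?thesis using m0 by (simp add: field_simps)
  qed
  have "real n / real m \<le> real B + 1"
  proof -
    have "n \<le> (B + 1) * m" unfolding B_def using dividend_less_div_times[OF m0, of n] by simp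
    then have "real n \<le> (real B + 1) * real m"
      by (metis of_nat_1 of_nat_add of_nat_le_iff of_nat_mult)
    then show ?thesis using m0 by (simp add: field_simps)
  qed
  then have B: "x / 24 \<le> real B"
    using xm x by linarith
  then have B0: "0 < B" using x by (cases B) auto
  \<comment> \<open>This is where \<open>x \<ge> 10000\<close> enters: \<open>96\<^sup>2 (1 + x) \<le> x\<^sup>2\<close>.\<close>
  have "sqrt (1 + x) \<le> x / 96"
  proof (rule real_le_lsqrt)
    have "9216 * (1 + x) \<le> 10000 * x" using x by simp
    also have "\<dots> \<le> x * x" using x by (intro mult_right_mono) auto
    finally show "1 + x \<le> (x / 96)\<^sup>2" by (simp add: power2_eq_square)
  qed (use x in auto)
  also have "\<dots> \<le> real B / 4" using B by simp
  finally have "(1 + x) powr (1 / 2) \<le> real B / 4" using x by (simp add: powr_half_sqrt)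
  then have "log 2 ((1 + x) powr (1 / 2)) \<le> log 2 (real B / 4)"
    using x B0 by (subst log_le_cancel_iff) auto
  then have LB: "L / 2 \<le> log 2 (real B / 4)" using x by (simp add: L_def log_powr)
  have "real k \<le> real m / 2 * (L / 2)"
    using m(1) L by (simp add: field_simps)
  also have "\<dots> \<le> real m / 2 * log 2 (real B / 4)"
    using LB by (intro mult_left_mono) auto
  finally have "2 powr real k \<le> 2 powr (real m / 2 * log 2 (real B / 4))" by simp
  also have "\<dots> = (real B / 4) powr (real m / 2)"
    using B0 by (subst mult.commute, subst powr_powr[symmetric]) simp
  finally have pow: "2 ^ k \<le> (real B / 4) powr (real m / 2)" by (simp add: powr_realpow)
  have "2 ^ (k - 1) * (2 ^ m * real B powr (real m / 2)) < 2 ^ k * (2 ^ m * real B powr (real m / 2))"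
    using k B0 by (intro mult_strict_right_mono power_strict_increasing) auto
  also have "\<dots> \<le> (real B / 4) powr (real m / 2) * (2 ^ m * real B powr (real m / 2))"
    using pow by (intro mult_right_mono) auto
  also have "\<dots> = real B ^ m"
  proof -
    have "(4::real) powr (real m / 2) = (2 powr 2) powr (real m / 2)" by simp
    also have "\<dots> = 2 ^ m" by (simp only: powr_powr) (simp add: powr_realpow)
    finally have "(4::real) powr (real m / 2) = 2 ^ m" .
    moreover have "real B powr (real m / 2) * real B powr (real m / 2) = real B ^ m"
      using B0 by (simp add: powr_add[symmetric] powr_realpow)
    ultimately show ?thesis by (simp add: powr_divide)
  qed
  finally have "real m powr (recip q - recip p) / (2 powr (recip q + 1) * 2 powr (1 + recip q))
      \<le> entropy_number k (lp_space p n) (lp_space q n) id"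
    by (intro entropy_number_ge_of_code[OF p m0 B0]) (simp_all add: B_def)
  moreover have "(1 / real k * L) powr s / 6 powr s \<le> real m powr (recip q - recip p)"
  proof -
    have "(1 / real k * L) powr s / 6 powr s = (6 * real k / L) powr (- s)"
      using k L by (simp add: powr_minus powr_divide powr_mult field_simps)
    also have "\<dots> \<le> real m powr (- s)"
      using m6 m0 s by (intro powr_mono2') auto
    finally show ?thesis by (simp add: s_def)
  qed
  then have "(1 / real k * L) powr s / 6 powr s / (2 powr (recip q + 1) * 2 powr (1 + recip q))
      \<le> real m powr (recip q - recip p) / (2 powr (recip q + 1) * 2 powr (1 + recip q))"
    by (intro divide_right_mono) auto
  ultimately show ?thesis by (simp add: s_def L_def x_def)
qed

section \<open>Two-sided estimate\<close>

theorem theorem38: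
  fixes p q :: ereal
  assumes "0 < p" and "p \<le> q" and "q \<le> \<infinity>"
  shows "\<exists>c > 0. \<exists>C > 0. \<forall>n \<ge> (1::nat). \<forall>k \<ge> (1::nat).
    (let e = entropy_number k (lp_space p n) (lp_space q n) id;
         a = 1;
         b = (1 / real k * log 2 (1 + 2 * real n / real k))
               powr (real_of_ereal (1 / p) - real_of_ereal (1 / q));
         d = 2 powr (- (real k / (2 * real n)))
               * (2 * real n) powr (real_of_ereal (1 / q) - real_of_ereal (1 / p))
     in (real k \<le> log 2 (2 * real n) \<longrightarrow> c * a \<le> e \<and> e \<le> C * a) \<and>
        (log 2 (2 * real n) \<le> real k \<and> k \<le> 2 * n \<longrightarrow> c * b \<le> e \<and> e \<le> C * b) \<and>
        (2 * n \<le> k \<longrightarrow> c * d \<le> e \<and> e \<le> C * d))"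
proof -
  have p: "0 < p" "p \<le> q" using assms by auto
  define e where "e k n = entropy_number k (lp_space p n) (lp_space q n) id" for k n
  define s where "s = recip p - recip q"
  have s: "0 \<le> s" using recip_antimono[OF p] by (simp add: s_def)
  have ms: "recip q - recip p = - s" by (simp add: s_def)
  define b where "b k n = (1 / real k * log 2 (1 + 2 * real n / real k)) powr s" for k n
  define t where "t k n = 2 powr (- (real k / (2 * real n)))" for k n :: nat
  define d where "d k n = t k n * (2 * real n) powr (- s)" for k n
  have d0: "0 \<le> d k n" for k n by (simp add: d_def t_def)
  have b0: "0 \<le> b k n" for k n by (simp add: b_def)
  have two: "real n powr (- s) = 2 powr s * (2 * real n) powr (- s)" for n
    by (simp add: powr_mult powr_minus)
  have two1: "1 \<le> 2 powr s" using s by (simp add: ge_one_powr_ge_zero)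

  define c\<^sub>1 where "c\<^sub>1 = 1 / (2 * 2 powr (1 + recip q))"
  have low1: "c\<^sub>1 \<le> e k n" if "0 < n" "2 ^ (k - 1) \<le> n" for k n
    unfolding c\<^sub>1_def e_def by (rule entropy_number_ge_small[OF p that])
  obtain c\<^sub>2 where c2: "0 < c\<^sub>2"
    and low2: "\<And>n k. 0 < n \<Longrightarrow> 0 < k \<Longrightarrow> c\<^sub>2 * t k n * real n powr (- s) \<le> e k n"
    using entropy_number_ge_dense[OF p] unfolding e_def t_def ms by metis
  define c\<^sub>3 where "c\<^sub>3 = 1 / (6 powr s * (2 powr (recip q + 1) * 2 powr (1 + recip q)))"
  have low3: "c\<^sub>3 * b k n \<le> e k n"
    if "0 < n" "0 < k" "log 2 (2 * real n) \<le> real k" "10000 * real k \<le> 2 * real n" for k n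
    unfolding c\<^sub>3_def b_def e_def s_def by (rule entropy_number_ge_sparse[OF p that])
  define A where "A = 5000 * log 2 (10001::real)"
  have A0: "0 < A" by (simp add: A_def)
  define c\<^sub>4 where "c\<^sub>4 = c\<^sub>2 / 2 * A powr (- s)"
  \<comment> \<open>If \<open>n\<close> and \<open>k\<close> are comparable, then \<open>b k n\<close> is of order \<open>n\<^bsup>-s\<^esup>\<close>, and the grid is good enough.\<close>
  have low4: "c\<^sub>4 * b k n \<le> e k n"
    if n: "0 < n" and k: "0 < k" "k \<le> 2 * n" and large: "2 * real n < 10000 * real k" for k n
  proof -
    have "1 / real k * log 2 (1 + 2 * real n / real k) \<le> (5000 / real n) * log 2 10001"
      using n k large by (intro mult_mono) (auto simp: field_simps)
    also have "\<dots> = A / real n" by (simp add: A_def)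
    finally have "1 / real k * log 2 (1 + 2 * real n / real k) \<le> A / real n" .
    moreover have "0 \<le> log 2 (1 + 2 * real n / real k)"
      using k by (subst zero_le_log_cancel_iff) (auto intro: add_pos_nonneg)
    ultimately have "b k n \<le> (A / real n) powr s"
      unfolding b_def using s by (intro powr_mono2) auto
    then have "c\<^sub>4 * b k n \<le> c\<^sub>4 * (A / real n) powr s"
      using c2 by (intro mult_left_mono) (auto simp: c\<^sub>4_def)
    also have "\<dots> = c\<^sub>2 * (1 / 2) * real n powr (- s)"
      using A0 n by (simp add: c\<^sub>4_def powr_divide powr_minus field_simps)
    also have "\<dots> \<le> c\<^sub>2 * t k n * real n powr (- s)"
    proof -
      have "2 powr (- 1) \<le> t k n"
        unfolding t_def using k n by (intro powr_mono) (auto simp: field_simps)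
      then show ?thesis using c2 by (intro mult_right_mono mult_left_mono) (auto simp: powr_minus)
    qed
    also have "\<dots> \<le> e k n" using low2 n k by blast
    finally show ?thesis .
  qed

  have up1: "e k n \<le> 1" if "0 < n" for k n
    unfolding e_def by (rule entropy_number_le_one[OF p that])
  obtain C\<^sub>2 where C2: "0 < C\<^sub>2"
    and up2: "\<And>n k k'. 0 < k' \<Longrightarrow> k' \<le> 2 * n \<Longrightarrow> k' \<le> k \<Longrightarrow> e k n \<le> C\<^sub>2 * b k' n"
    using entropy_number_le_medium[OF p] unfolding e_def b_def s_def by metis
  define D where "D = 6 * exp (2 * (1 + recip p))"
  have D: "1 \<le> D"
    unfolding D_def using mult_mono[of 1 6 1 "exp (2 * (1 + recip p))"] recip_nonneg[OF p(1)] by simp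
  define C\<^sub>3 where "C\<^sub>3 = max (2 * D * 2 powr s) (C\<^sub>2 * D)"
  have up3: "e k n \<le> C\<^sub>3 * d k n" if n: "0 < n" and k: "2 * n \<le> k" for k n
  \<comment> \<open>For \<open>k\<close> not much larger than \<open>2n\<close> the factor \<open>2\<^bsup>-k/2n\<^esup>\<close> is bounded below, and the estimate for
    \<open>2n\<close> in place of \<open>k\<close> is good enough.\<close>
  proof (cases "D \<le> 2 powr (real k / (2 * real n))")
    case True
    have "0 < k" using n k by simp
    then have "e k n \<le> 2 * D * t k n * real n powr (- s)"
      unfolding e_def t_def ms[symmetric]
      by (rule entropy_number_le_large[OF p n _ D_def True])
    also have "\<dots> = 2 * D * 2 powr s * d k n"
      by (simp add: two d_def)
    also have "\<dots> \<le> C\<^sub>3 * d k n"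
      using d0 by (intro mult_right_mono) (auto simp: C\<^sub>3_def)
    finally show ?thesis .
  next
    case False
    have "e k n \<le> C\<^sub>2 * b (2 * n) n" using n k by (intro up2) auto
    also have "b (2 * n) n = (2 * real n) powr (- s)"
      using n by (simp add: b_def powr_minus powr_divide inverse_eq_divide)
    also have "(2 * real n) powr (- s) \<le> D * t k n * (2 * real n) powr (- s)"
    proof -
      have "1 \<le> D * t k n"
        using False by (simp add: t_def powr_minus field_simps)
      then show ?thesis using mult_right_mono[of 1 "D * t k n" "(2 * real n) powr (- s)"] by simp
    qed
    then have "C\<^sub>2 * (2 * real n) powr (- s) \<le> C\<^sub>2 * (D * t k n * (2 * real n) powr (- s))"
      using C2 by (intro mult_left_mono) auto
    also have "\<dots> = C\<^sub>2 * D * d k n" by (simp add: d_def)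
    also have "\<dots> \<le> C\<^sub>3 * d k n"
      using d0 by (intro mult_right_mono) (auto simp: C\<^sub>3_def)
    finally show ?thesis .
  qed

  define c where "c = Min {c\<^sub>1, c\<^sub>2, c\<^sub>3, c\<^sub>4}"
  define C where "C = Max {1, C\<^sub>2, C\<^sub>3}"
  have c: "0 < c" "c \<le> c\<^sub>1" "c \<le> c\<^sub>2" "c \<le> c\<^sub>3" "c \<le> c\<^sub>4"
    using c2 A0 by (auto simp: c_def c\<^sub>1_def c\<^sub>3_def c\<^sub>4_def)
  have C: "0 < C" "1 \<le> C" "C\<^sub>2 \<le> C" "C\<^sub>3 \<le> C"
    unfolding C_def by (auto simp: less_max_iff_disj)
  have main: "(real k \<le> log 2 (2 * real n) \<longrightarrow> c * 1 \<le> e k n \<and> e k n \<le> C * 1) \<and>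
      (log 2 (2 * real n) \<le> real k \<and> k \<le> 2 * n \<longrightarrow> c * b k n \<le> e k n \<and> e k n \<le> C * b k n) \<and>
      (2 * n \<le> k \<longrightarrow> c * d k n \<le> e k n \<and> e k n \<le> C * d k n)"
    if nk: "1 \<le> n" "1 \<le> k" for n k
  proof (intro conjI impI)
    have n: "0 < n" and k: "0 < k" using nk by auto
    show "e k n \<le> C * 1" using up1[OF n, of k] C by simp
    {
      assume "real k \<le> log 2 (2 * real n)"
      then have "2 powr real k \<le> 2 * real n" using n by (simp add: le_log_iff)
      then have "real (2 ^ k) \<le> real (2 * n)" by (simp add: powr_realpow)
      then have "2 ^ k \<le> 2 * n" by (simp only: of_nat_le_iff)
      then have "2 ^ (k - 1) \<le> n" using k by (cases k) auto
      then show "c * 1 \<le> e k n" using low1[OF n] c by fastforce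
    }
    {
      assume k2: "log 2 (2 * real n) \<le> real k \<and> k \<le> 2 * n"
      show "c * b k n \<le> e k n"
      proof (cases "10000 * real k \<le> 2 * real n")
        case True
        have "c * b k n \<le> c\<^sub>3 * b k n" using c b0 by (intro mult_right_mono) auto
        then show ?thesis using low3[OF n k _ True] k2 by linarith
      next
        case False
        have "c * b k n \<le> c\<^sub>4 * b k n" using c b0 by (intro mult_right_mono) auto
        then show ?thesis using low4[OF n k] k2 False by linarith
      qed
      have "C\<^sub>2 * b k n \<le> C * b k n" using C b0 by (intro mult_right_mono) auto
      then show "e k n \<le> C * b k n" using up2[of k n k] k k2 by linarith
    }
    {
      assume k3: "2 * n \<le> k"
      have "c * d k n \<le> c\<^sub>2 * d k n" using c d0 by (intro mult_right_mono) auto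
      also have "\<dots> \<le> 2 powr s * (c\<^sub>2 * d k n)"
        using mult_right_mono[OF two1, of "c\<^sub>2 * d k n"] c2 d0 by simp
      also have "\<dots> = c\<^sub>2 * t k n * real n powr (- s)" by (simp add: two d_def)
      also have "\<dots> \<le> e k n" using low2 n k by blast
      finally show "c * d k n \<le> e k n" .
      have "C\<^sub>3 * d k n \<le> C * d k n" using C d0 by (intro mult_right_mono) auto
      then show "e k n \<le> C * d k n" using up3[OF n k3] by linarith
    }
  qed
  show ?thesis
    unfolding Let_def
    using main[unfolded e_def b_def d_def t_def ms[symmetric] s_def] c(1) C(1)
    by (intro exI[of _ c] conjI exI[of _ C]) auto
qed

end
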